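(* Let $G$ be a $2$-connected graph which is not a cycle. If $G$ is $\{K_{1,3},Z_1\}$-$f_1$-heavy, then $G$ is pancyclic.
   Context: All graphs are finite and simple. Let $G$ be a graph on $n$ vertices, and $d(x)$ the degree of $x$ in $G$. For a subgraph $H$ and $x,y\in V(H)$, $d_H(x,y)$ is the length of a shortest $(x,y)$-path in $H$. An induced subgraph $H$ of $G$ is called $f_1$-heavy if for every pair of vertices $u,v\in V(H)$ with $d_H(u,v)=2$ we have $\max\{d(u),d(v)\}\geq (n+1)/2$ (degrees taken in $G$). For a graph $R$, $G$ is $R$-$f_1$-heavy if every induced subgraph of $G$ isomorphic to $R$ is $f_1$-heavy; for a family $\mathcal{R}$ of graphs, $G$ is $\mathcal{R}$-$f_1$-heavy if it is $R$-$f_1$-heavy for every $R\in\mathcal{R}$. $K_{1,3}$ is the claw. $Z_1$ is the graph obtained from the path $a_1a_2a_3a_4$ by adding the edge $a_1a_3$ (a triangle with one pendant edge). A graph on $n$ vertices is pancyclic if it contains cycles of every length from $3$ to $n$. *)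

theory Defs
  imports Complex_Main
begin

definition graph :: "'a set \<Rightarrow> ('a \<Rightarrow> 'a \<Rightarrow> bool) \<Rightarrow> bool" where
  "graph V E \<longleftrightarrow> finite V \<and> (\<forall>x y. E x y \<longrightarrow> E y x) \<and> (\<forall>x. \<not> E x x)
     \<and> (\<forall>x y. E x y \<longrightarrow> x \<in> V \<and> y \<in> V)"

definition degree :: "'a set \<Rightarrow> ('a \<Rightarrow> 'a \<Rightarrow> bool) \<Rightarrow> 'a \<Rightarrow> nat" where
  "degree V E x = card {y \<in> V. E x y}"

definition is_path_in :: "'a set \<Rightarrow> ('a \<Rightarrow> 'a \<Rightarrow> bool) \<Rightarrow> 'a list \<Rightarrow> bool" where
  "is_path_in S E p \<longleftrightarrow> p \<noteq> [] \<and> distinct p \<and> set p \<subseteq> S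
     \<and> (\<forall>i. Suc i < length p \<longrightarrow> E (p ! i) (p ! Suc i))"

definition connected_on :: "'a set \<Rightarrow> ('a \<Rightarrow> 'a \<Rightarrow> bool) \<Rightarrow> bool" where
  "connected_on S E \<longleftrightarrow> S \<noteq> {} \<and>
     (\<forall>x\<in>S. \<forall>y\<in>S. \<exists>p. is_path_in S E p \<and> hd p = x \<and> last p = y)"

definition two_connected :: "'a set \<Rightarrow> ('a \<Rightarrow> 'a \<Rightarrow> bool) \<Rightarrow> bool" where
  "two_connected V E \<longleftrightarrow> card V \<ge> 3 \<and> connected_on V E
     \<and> (\<forall>v\<in>V. connected_on (V - {v}) E)"

definition is_cycle :: "'a set \<Rightarrow> ('a \<Rightarrow> 'a \<Rightarrow> bool) \<Rightarrow> 'a list \<Rightarrow> bool" where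
  "is_cycle V E c \<longleftrightarrow> length c \<ge> 3 \<and> distinct c \<and> set c \<subseteq> V
     \<and> (\<forall>i<length c. E (c ! i) (c ! ((i + 1) mod length c)))"

definition is_cycle_graph :: "'a set \<Rightarrow> ('a \<Rightarrow> 'a \<Rightarrow> bool) \<Rightarrow> bool" where
  "is_cycle_graph V E \<longleftrightarrow> (\<exists>c. is_cycle V E c \<and> set c = V \<and>
     (\<forall>x y. E x y \<longrightarrow> (\<exists>i<length c. {x, y} = {c ! i, c ! ((i + 1) mod length c)})))"

definition pancyclic :: "'a set \<Rightarrow> ('a \<Rightarrow> 'a \<Rightarrow> bool) \<Rightarrow> bool" where
  "pancyclic V E \<longleftrightarrow> (\<forall>k. 3 \<le> k \<and> k \<le> card V \<longrightarrow> (\<exists>c. is_cycle V E c \<and> length c = k))"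

definition dist2_in :: "'a set \<Rightarrow> ('a \<Rightarrow> 'a \<Rightarrow> bool) \<Rightarrow> 'a \<Rightarrow> 'a \<Rightarrow> bool" where
  "dist2_in S E u v \<longleftrightarrow> u \<in> S \<and> v \<in> S \<and> u \<noteq> v \<and> \<not> E u v \<and> (\<exists>w\<in>S. E u w \<and> E w v)"

definition f1_heavy :: "'a set \<Rightarrow> ('a \<Rightarrow> 'a \<Rightarrow> bool) \<Rightarrow> 'a set \<Rightarrow> bool" where
  "f1_heavy V E S \<longleftrightarrow> (\<forall>u\<in>S. \<forall>v\<in>S. dist2_in S E u v \<longrightarrow>
     real (max (degree V E u) (degree V E v)) \<ge> (real (card V) + 1) / 2)"

definition induced_iso :: "'a set \<Rightarrow> ('a \<Rightarrow> 'a \<Rightarrow> bool) \<Rightarrow> 'b set \<Rightarrow> ('b \<Rightarrow> 'b \<Rightarrow> bool) \<Rightarrow> 'a set \<Rightarrow> bool" where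
  "induced_iso V E RV RE S \<longleftrightarrow> S \<subseteq> V \<and>
     (\<exists>f. bij_betw f RV S \<and> (\<forall>x\<in>RV. \<forall>y\<in>RV. RE x y \<longleftrightarrow> E (f x) (f y)))"

definition R_f1_heavy :: "'a set \<Rightarrow> ('a \<Rightarrow> 'a \<Rightarrow> bool) \<Rightarrow> 'b set \<Rightarrow> ('b \<Rightarrow> 'b \<Rightarrow> bool) \<Rightarrow> bool" where
  "R_f1_heavy V E RV RE \<longleftrightarrow> (\<forall>S. induced_iso V E RV RE S \<longrightarrow> f1_heavy V E S)"

definition claw_V :: "nat set" where "claw_V = {0, 1, 2, 3}"
definition claw_E :: "nat \<Rightarrow> nat \<Rightarrow> bool" where
  "claw_E x y \<longleftrightarrow> x \<in> claw_V \<and> y \<in> claw_V \<and> x \<noteq> y \<and> (x = 0 \<or> y = 0)"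

definition Z1_V :: "nat set" where "Z1_V = {1, 2, 3, 4}"
definition Z1_E :: "nat \<Rightarrow> nat \<Rightarrow> bool" where
  "Z1_E x y \<longleftrightarrow> {x, y} \<in> {{1, 2}, {2, 3}, {3, 4}, {1, 3}}"

end

theory Submission
  imports Defs
begin

text \<open>
  Call a vertex light if its degree is at most \<open>n / 2\<close>, heavy otherwise. If \<open>u\<close>, \<open>v\<close> are nonadjacent
  light vertices with a common neighbour \<open>w\<close>, then every further neighbour of \<open>w\<close> is adjacent to both
  \<open>u\<close> and \<open>v\<close>: otherwise \<open>u\<close>, \<open>v\<close>, \<open>w\<close> lie in an induced claw or \<open>Z\<^sub>1\<close>. Hence the light
  neighbours of a heavy vertex form a clique, and each component of the graph induced by the light
  vertices is a clique or has a Hamiltonian path whose inner vertices have no neighbours outside the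
  component. If there is no heavy vertex, the graph is 2-regular, hence a cycle. Otherwise
  2-connectivity attaches both ends of a Hamiltonian path of each light component to different heavy
  vertices; these paths close up to a Hamiltonian cycle once all pairs of heavy vertices are joined,
  and the added edges can be removed again by the Bondy-Chvatal closure argument. A counting
  argument shows that every Hamiltonian cycle contains two consecutive heavy vertices (up to
  rotation, its ends), and such a cycle yields all shorter ones by Bondy's pigeonhole argument.
\<close>

section \<open>Paths and cycles as lists, and cuts of connected graphs\<close>

lemma is_cycleI:
  assumes "distinct xs" "set xs \<subseteq> V" "3 \<le> length xs" "successively E xs" "E (last xs) (hd xs)"
  shows "is_cycle V E xs"
  unfolding is_cycle_def
proof (intro conjI allI impI)
  fix i assume i: "i < length xs"
  show "E (xs ! i) (xs ! ((i + 1) mod length xs))"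
  proof (cases "Suc i < length xs")
    case True
    then show ?thesis using assms(4) by (simp add: successively_conv_nth)
  next
    case False
    then have "Suc i = length xs" using i by simp
    moreover have "xs \<noteq> []" using i by auto
    ultimately have "xs ! i = last xs" "xs ! ((i + 1) mod length xs) = hd xs"
      by (auto simp: last_conv_nth hd_conv_nth simp flip: \<open>Suc i = length xs\<close>)
    then show ?thesis using assms(5) by simp
  qed
qed (use assms in auto)

text \<open>On a path from \<open>S\<close> to \<open>T - S\<close>, the first vertex outside
  \<open>S\<close> and its predecessor give the crossing edge. Connectivity is used below only in
  this cut form.\<close>

lemma connected_on_cut:
  assumes "connected_on T E" "S \<subseteq> T" "S \<noteq> {}" "S \<noteq> T"
  shows "\<exists>x\<in>S. \<exists>y\<in>T - S. E x y"
proof -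
  obtain x y where x: "x \<in> S" and y: "y \<in> T" "y \<notin> S" using assms by blast
  obtain p where p: "is_path_in T E p" "hd p = x" "last p = y"
    using assms x y unfolding connected_on_def by blast
  have ne: "p \<noteq> []" using p by (auto simp: is_path_in_def)
  let ?P = "\<lambda>i. i < length p \<and> p ! i \<notin> S"
  have ex: "?P (length p - 1)" using ne p y by (auto simp: last_conv_nth)
  define i where "i = (LEAST i. ?P i)"
  have i: "?P i" unfolding i_def using ex by (rule LeastI)
  have "i \<noteq> 0" using i p x ne by (metis hd_conv_nth)
  then obtain j where j: "i = Suc j" by (cases i) auto
  have "p ! j \<in> S" using not_less_Least[of j ?P] i unfolding i_def[symmetric] j by auto
  moreover have "p ! i \<in> T" "E (p ! j) (p ! i)" using p i j unfolding is_path_in_def by auto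
  ultimately show ?thesis using i by blast
qed

lemma successively_clique:
  assumes "distinct xs" "\<And>x y. x \<in> set xs \<Longrightarrow> y \<in> set xs \<Longrightarrow> x \<noteq> y \<Longrightarrow> E x y"
  shows "successively E xs"
  unfolding successively_conv_nth
  using assms by (auto simp: nth_eq_iff_index_eq)

text \<open>Membership in \<open>S\<close> spreads along the path from \<open>y\<close>, forwards
  and, after reversal, backwards. So a light path that meets a light-closed set lies inside
  it.\<close>

lemma successively_subset_closed:
  assumes "successively E p" and sym: "\<And>x y. E x y \<Longrightarrow> E y x"
    and closed: "\<And>x y. x \<in> S \<Longrightarrow> E x y \<Longrightarrow> y \<in> set p \<Longrightarrow> y \<in> S"
    and y: "y \<in> set p" "y \<in> S"
  shows "set p \<subseteq> S"
proof -
  have fwd: "set xs \<subseteq> S" if "successively E xs" "xs \<noteq> []" "hd xs \<in> S" "set xs \<subseteq> set p" for xs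
    using that
  proof (induction xs)
    case (Cons x xs)
    then show ?case using closed[of x "hd xs"] by (cases xs) auto
  qed simp
  obtain as bs where p: "p = as @ y # bs" using y by (meson split_list)
  have "successively E (as @ [y])" using assms(1) unfolding p by (auto simp: successively_append_iff)
  then have "successively E (rev (as @ [y]))"
    unfolding successively_rev by (rule successively_mono) (rule sym)
  then have "set (rev (as @ [y])) \<subseteq> S" using y p by (intro fwd) auto
  moreover have "set (y # bs) \<subseteq> S" using assms(1) y p by (intro fwd) (auto simp: successively_append_iff)
  ultimately show ?thesis using p by auto
qed

definition hamiltonian_list :: "'a set \<Rightarrow> ('a \<Rightarrow> 'a \<Rightarrow> bool) \<Rightarrow> 'a list \<Rightarrow> bool" where
  "hamiltonian_list V E xs \<longleftrightarrow> distinct xs \<and> set xs = V \<and> successively E xs \<and> E (last xs) (hd xs)"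

lemma hamiltonian_list_rotate:
  assumes "hamiltonian_list V E (as @ bs)" 
  shows "hamiltonian_list V E (bs @ as)"
proof (cases "as = [] \<or> bs = []")
  case True
  then show ?thesis using assms by auto
next
  case False
  then show ?thesis using assms unfolding hamiltonian_list_def by (auto simp: successively_append_iff)
qed

lemma hamiltonian_list_rotate_edge:
  assumes "hamiltonian_list V E xs" and i: "Suc i < length xs"
  shows "\<exists>ys. hamiltonian_list V E ys \<and> hd ys = xs ! Suc i \<and> last ys = xs ! i"
proof -
  let ?a = "take (Suc i) xs" and ?b = "drop (Suc i) xs"
  have "hamiltonian_list V E (?b @ ?a)"
    using assms(1) hamiltonian_list_rotate[of V E ?a ?b] by simp
  moreover have "?a = take i xs @ [xs ! i]" "?b \<noteq> []" using i by (auto simp: take_Suc_conv_app_nth)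
  then have "hd (?b @ ?a) = xs ! Suc i" "last (?b @ ?a) = xs ! i"
    using i by (auto simp: hd_drop_conv_nth)
  ultimately show ?thesis by blast
qed

section \<open>Hamiltonian cycles and the degree sum of their edges\<close>

locale simple_graph =
  fixes V :: "'a set" and E :: "'a \<Rightarrow> 'a \<Rightarrow> bool"
  assumes fin: "finite V" and sym: "E x y \<Longrightarrow> E y x" and irr: "\<not> E x x"
    and inV: "E x y \<Longrightarrow> x \<in> V \<and> y \<in> V"
begin

lemma degree_eq: "degree V E x = card {y. E x y}"
  unfolding degree_def by (rule arg_cong[where f = card]) (use inV in blast)

lemma finite_nbrs [simp]: "finite {y. E x y}"
  by (rule finite_subset[OF _ fin]) (use inV in blast)

lemma successively_rev_sym: "successively E (rev xs) \<longleftrightarrow> successively E xs"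
proof -
  have "(\<lambda>x y. E y x) = E" using sym by blast
  then show ?thesis unfolding successively_rev by (rule arg_cong)
qed

lemma card_nbrs_index:
  assumes "distinct xs" "set xs = V"
  shows "card {i. i < length xs \<and> E x (xs ! i)} = degree V E x"
proof -
  have "bij_betw ((!) xs) {i. i < length xs \<and> E x (xs ! i)} {y. E x y}"
  proof (rule bij_betwI')
    fix i j assume "i \<in> {i. i < length xs \<and> E x (xs ! i)}" "j \<in> {i. i < length xs \<and> E x (xs ! i)}"
    then show "(xs ! i = xs ! j) = (i = j)" using assms nth_eq_iff_index_eq by blast
  next
    fix y assume "y \<in> {y. E x y}"
    then show "\<exists>i\<in>{i. i < length xs \<and> E x (xs ! i)}. y = xs ! i"
      using assms inV by (metis (mono_tags, lifting) in_set_conv_nth mem_Collect_eq)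
  qed auto
  then show ?thesis by (simp add: degree_eq bij_betw_same_card)
qed

text \<open>Ore's crossing argument: \<open>?A\<close> and \<open>?B\<close> lie among the
  \<open>n - 1\<close> positions that have a successor, and their sizes add up to at least
  \<open>n\<close>, so they share some \<open>i\<close>. Reversing the list up to position
  \<open>i\<close> gives a path closed by the edge from \<open>last xs\<close> to
  \<open>xs ! i\<close>.\<close>

lemma ore_crossing:
  assumes xs: "distinct xs" "set xs = V" "successively E xs" "xs \<noteq> []"
    and n: "\<not> E (hd xs) (last xs)"
    and d: "card V \<le> degree V E (hd xs) + degree V E (last xs)"
  shows "\<exists>ys. hamiltonian_list V E ys"
proof -
  let ?n = "length xs"
  have len: "?n = card V" using xs distinct_card by fastforce
  let ?A = "{i. Suc i < ?n \<and> E (hd xs) (xs ! Suc i)}"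
  let ?B = "{i. Suc i < ?n \<and> E (last xs) (xs ! i)}"
  have "Suc ` ?A = {i. i < ?n \<and> E (hd xs) (xs ! i)}"
  proof (intro equalityI subsetI)
    fix i assume i: "i \<in> {i. i < ?n \<and> E (hd xs) (xs ! i)}"
    then have "i \<noteq> 0" using xs(4) irr[of "xs ! 0"] by (auto simp: hd_conv_nth intro!: gr0I)
    then obtain j where "i = Suc j" by (cases i) auto
    then show "i \<in> Suc ` ?A" using i by auto
  qed auto
  then have A: "card ?A = degree V E (hd xs)"
    using card_nbrs_index[OF xs(1,2)] card_image[of Suc ?A] by simp
  have "?B = {i. i < ?n \<and> E (last xs) (xs ! i)}"
  proof (intro equalityI subsetI)
    fix i assume i: "i \<in> {i. i < ?n \<and> E (last xs) (xs ! i)}"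
    then have "i \<noteq> ?n - 1" using xs(4) irr by (auto simp: last_conv_nth)
    then show "i \<in> ?B" using i by auto
  qed auto
  then have B: "card ?B = degree V E (last xs)"
    using card_nbrs_index[OF xs(1,2)] by simp
  have "card (?A \<union> ?B) \<le> card {..<?n - 1}" by (rule card_mono) auto
  moreover have "0 < ?n" using xs(4) by simp
  ultimately have lt: "card (?A \<union> ?B) < card ?A + card ?B"
    unfolding A B using d len by simp
  have "finite ?A" "finite ?B" by (auto intro: finite_subset[of _ "{..<?n}"])
  then have "?A \<inter> ?B \<noteq> {}" using lt card_Un_disjoint[of ?A ?B] by auto
  then obtain i where i: "Suc i < ?n" "E (hd xs) (xs ! Suc i)" "E (last xs) (xs ! i)" by blast
  let ?a = "take (Suc i) xs" and ?b = "drop (Suc i) xs"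
  have ne: "?a \<noteq> []" "?b \<noteq> []" using i by auto
  have e: "hd ?a = hd xs" "last ?a = xs ! i" "hd ?b = xs ! Suc i" "last ?b = last xs"
    using i ne by (simp_all add: hd_take hd_drop_conv_nth) (simp add: take_Suc_conv_app_nth)
  have "successively E (?a @ ?b)" using xs by simp
  then have s: "successively E ?a" "successively E ?b" unfolding successively_append_iff by auto
  have "hamiltonian_list V E (rev ?a @ ?b)"
    unfolding hamiltonian_list_def
  proof (intro conjI)
    have "distinct (?a @ ?b)" "set (?a @ ?b) = V" using xs by simp_all
    then show "distinct (rev ?a @ ?b)" "set (rev ?a @ ?b) = V" unfolding distinct_append set_append by simp_all
    show "successively E (rev ?a @ ?b)"
      using s ne e i unfolding successively_append_iff successively_rev_sym by (simp add: last_rev)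
    show "E (last (rev ?a @ ?b)) (hd (rev ?a @ ?b))"
      using ne e i by (simp add: hd_rev)
  qed
  then show ?thesis by blast
qed

text \<open>A Hamiltonian cycle that uses the added edge \<open>xy\<close> is cut open there. What
  remains is a Hamiltonian path of \<open>E\<close> with ends \<open>x\<close> and \<open>y\<close>,
  to which \<open>ore_crossing\<close> applies.\<close>

lemma ore_closure_step:
  assumes E': "\<And>a b. E' a b \<longleftrightarrow> E a b \<or> {a, b} = {x, y}"
    and ham: "hamiltonian_list V E' xs"
    and "3 \<le> card V" and ne: "x \<noteq> y"
    and d: "card V \<le> degree V E x + degree V E y"
  shows "\<exists>ys. hamiltonian_list V E ys"
proof (cases "E x y \<or> hamiltonian_list V E xs")
  case True
  then show ?thesis
  proof
    assume "E x y"
    then have "E' a b \<longleftrightarrow> E a b" for a b using E'[of a b] sym by (auto simp: doubleton_eq_iff)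
    then have "E' = E" by blast
    then show ?thesis using ham by auto
  qed auto
next
  case False
  obtain ys where ys: "hamiltonian_list V E' ys" "{hd ys, last ys} = {x, y}"
  proof (cases "E (last xs) (hd xs)")
    case False
    then show ?thesis using that ham E' unfolding hamiltonian_list_def by (metis insert_commute)
  next
    case True
    then have "\<not> successively E xs" using False ham unfolding hamiltonian_list_def by auto
    then obtain i where i: "Suc i < length xs" "\<not> E (xs ! i) (xs ! Suc i)"
      unfolding successively_conv_nth by auto
    then have "E' (xs ! i) (xs ! Suc i)" using ham unfolding hamiltonian_list_def successively_conv_nth by auto
    then have h: "{xs ! i, xs ! Suc i} = {x, y}" using i E' by blast
    obtain ys where "hamiltonian_list V E' ys" "hd ys = xs ! Suc i" "last ys = xs ! i"
      using hamiltonian_list_rotate_edge[OF ham i(1)] by blast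
    then show ?thesis using that h by (metis insert_commute)
  qed
  have nE: "\<not> E x y" using False by auto
  have len: "length ys = card V" using ys unfolding hamiltonian_list_def by (metis distinct_card)
  then have ne': "ys \<noteq> []" using assms(3) by auto
  have "successively E ys"
    unfolding successively_conv_nth
  proof (intro allI impI)
    fix i assume i: "Suc i < length ys"
    have d: "distinct ys" and "E' (ys ! i) (ys ! Suc i)"
      using ys i unfolding hamiltonian_list_def successively_conv_nth by auto
    \<comment> \<open>With at least three vertices, no step along the path joins the two ends, so
      \<open>xy\<close> occurs only as the closing edge.\<close>
    moreover have "{ys ! i, ys ! Suc i} \<noteq> {ys ! 0, ys ! (length ys - 1)}"
    proof
      assume "{ys ! i, ys ! Suc i} = {ys ! 0, ys ! (length ys - 1)}"
      then have "ys ! Suc i = ys ! (length ys - 1) \<and> ys ! i = ys ! 0 \<or> ys ! Suc i = ys ! 0"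
        by (auto simp: doubleton_eq_iff)
      then show False using d i len assms(3) by (auto simp: nth_eq_iff_index_eq)
    qed
    ultimately show "E (ys ! i) (ys ! Suc i)" using E' ys ne' by (auto simp: hd_conv_nth last_conv_nth)
  qed
  moreover have "\<not> E (hd ys) (last ys)" "card V \<le> degree V E (hd ys) + degree V E (last ys)"
    using ys(2) nE d sym by (auto simp: doubleton_eq_iff)
  ultimately show ?thesis using ore_crossing ys ne' unfolding hamiltonian_list_def by blast
qed

end

text \<open>The added edges are removed one at a time. The degree condition refers to
  \<open>E\<close>, and degrees only grow when edges are added, so it holds at every stage.\<close>

lemma ore_closure:
  assumes "simple_graph V E" "3 \<le> card V"
    and "finite F"
    and "\<And>x y. (x, y) \<in> F \<Longrightarrow> x \<noteq> y \<and> x \<in> V \<and> y \<in> V \<and> card V \<le> degree V E x + degree V E y"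
    and "hamiltonian_list V (\<lambda>x y. E x y \<or> (x, y) \<in> F \<or> (y, x) \<in> F) xs"
  shows "\<exists>ys. hamiltonian_list V E ys"
  using assms(3-)
proof (induction F arbitrary: xs rule: finite_induct)
  case empty
  then show ?case by auto
next
  case (insert e F)
  obtain x y where e: "e = (x, y)" by force
  let ?E = "\<lambda>x y. E x y \<or> (x, y) \<in> F \<or> (y, x) \<in> F"
  interpret simple_graph V E by fact
  interpret G: simple_graph V ?E
    by unfold_locales (use fin sym irr inV insert.prems(1) in blast)+
  have deg: "degree V E z \<le> degree V ?E z" for z
    unfolding degree_eq G.degree_eq by (rule card_mono[OF G.finite_nbrs]) auto
  have xy: "x \<noteq> y" "card V \<le> degree V E x + degree V E y" using insert.prems(1)[of x y] e by auto
  then have "card V \<le> degree V ?E x + degree V ?E y" using deg[of x] deg[of y] by linarith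
  then have "\<exists>ys. hamiltonian_list V ?E ys"
    by (intro G.ore_closure_step[OF _ insert.prems(2) assms(2) xy(1)]) (auto simp: e doubleton_eq_iff)
  then show ?case using insert.IH insert.prems(1) by blast
qed

context simple_graph
begin

lemma pancyclic_of_heavy_edge:
  assumes ham: "hamiltonian_list V E xs" and c3: "3 \<le> card V"
    and d: "card V + 1 \<le> degree V E (hd xs) + degree V E (last xs)"
  shows "pancyclic V E"
  unfolding pancyclic_def
proof (intro allI impI)
  fix k assume k: "3 \<le> k \<and> k \<le> card V"
  let ?n = "length xs"
  let ?x = "hd xs" and ?y = "last xs"
  have xs: "distinct xs" "set xs = V" "successively E xs" "E ?y ?x"
    using ham by (auto simp: hamiltonian_list_def)
  have len: "?n = card V" using xs distinct_card by fastforce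
  have ne: "xs \<noteq> []" using len c3 by auto
  have hx: "?x = xs ! 0" and hy: "?y = xs ! (?n - 1)" using ne by (auto simp: hd_conv_nth last_conv_nth)
  let ?J = "{1..?n - 2}"
  let ?A = "{j \<in> ?J. E ?x (xs ! j)}"
  let ?B = "{j \<in> ?J. E ?y (xs ! j)}"
  have "insert (?n - 1) ?A = {i. i < ?n \<and> E ?x (xs ! i)}"
  proof (intro equalityI subsetI)
    fix i assume i: "i \<in> {i. i < ?n \<and> E ?x (xs ! i)}"
    then have "i \<noteq> 0" using hx irr[of "xs ! 0"] by (auto intro!: gr0I)
    then show "i \<in> insert (?n - 1) ?A" using i by auto
  qed (use xs(4) sym hy len c3 in auto)
  then have "card (insert (?n - 1) ?A) = degree V E ?x"
    using card_nbrs_index[OF xs(1,2), of ?x] by simp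
  moreover have "?n - 1 \<notin> ?A" using len c3 by auto
  moreover have "finite ?A" by simp
  ultimately have A: "Suc (card ?A) = degree V E ?x"
    using card_insert_disjoint[of ?A "?n - 1"] by simp
  have "insert 0 ?B = {i. i < ?n \<and> E ?y (xs ! i)}"
  proof (intro equalityI subsetI)
    fix i assume i: "i \<in> {i. i < ?n \<and> E ?y (xs ! i)}"
    then have "i \<noteq> ?n - 1" using hy irr[of "xs ! (?n - 1)"] by auto
    then show "i \<in> insert 0 ?B" using i by auto
  qed (use xs(4) hx len c3 in auto)
  then have "card (insert (0) ?B) = degree V E ?y"
    using card_nbrs_index[OF xs(1,2), of ?y] by simp
  moreover have "0 \<notin> ?B" by auto
  moreover have "finite ?B" by simp
  ultimately have B: "Suc (card ?B) = degree V E ?y"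
    using card_insert_disjoint[of ?B "0"] by simp
  \<comment> \<open>If \<open>x\<close> is adjacent to the \<open>j\<close>-th and \<open>y\<close> to the \<open>f j\<close>-th vertex, there is a cycle of length \<open>k\<close>.\<close>
  define f where "f j = (if j + k \<le> ?n + 1 then j + k - 3 else j + k - ?n - 1)" for j
  have fJ: "f j \<in> ?J" if "j \<in> ?J" for j using that k len unfolding f_def by auto
  have "inj_on f ?J" unfolding inj_on_def f_def using k len by auto
  then have "inj_on f ?A" by (rule inj_on_subset) blast
  then have "card (f ` ?A) = card ?A" by (rule card_image)
  moreover have "f ` ?A \<union> ?B \<subseteq> ?J" using fJ by blast
  then have "card (f ` ?A \<union> ?B) \<le> card ?J" by (intro card_mono) auto
  moreover have "card ?J = ?n - 2" by simp
  ultimately have lt: "card (f ` ?A \<union> ?B) < card (f ` ?A) + card ?B"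
    using A B d len c3 by linarith
  have "finite (f ` ?A)" "finite ?B" by simp_all
  then have "f ` ?A \<inter> ?B \<noteq> {}" using lt card_Un_disjoint[of "f ` ?A" ?B] by linarith
  then obtain j where j: "1 \<le> j" "j \<le> ?n - 2" "E ?x (xs ! j)" "E ?y (xs ! f j)" by auto
  show "\<exists>c. is_cycle V E c \<and> length c = k"
  proof (cases "j + k \<le> ?n + 1")
    case True
    \<comment> \<open>This stretch occupies positions \<open>j\<close> to
      \<open>f j = j + k - 3\<close>; with \<open>?x\<close> and \<open>?y\<close> it has
      \<open>k\<close> vertices.\<close>
    let ?m = "take (k - 2) (drop j xs)"
    let ?c = "?x # ?m @ [?y]"
    have lm: "length ?m = k - 2" using True k len j by simp
    have mn: "?m \<noteq> []" using lm k by auto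
    have nth: "?m ! i = xs ! (j + i)" if "i < k - 2" for i using that True len by simp
    have "0 < k - 2" "k - 3 < k - 2" "length ?m - 1 = k - 3" "j + (k - 3) = f j"
      using k lm True by (auto simp: f_def)
    then have hm: "hd ?m = xs ! j" "last ?m = xs ! f j"
      using nth[of 0] nth[of "k - 3"] by (simp_all only: hd_conv_nth[OF mn] last_conv_nth[OF mn] add_0_right)
    have sm: "set ?m = (!) xs ` {j..<j + (k - 2)}"
    proof -
      have "?m = map (\<lambda>i. xs ! (i + j)) [0..<k - 2]"
        by (rule nth_equalityI) (use lm nth in \<open>auto simp: add.commute\<close>)
      also have "\<dots> = map ((!) xs) (map (\<lambda>i. i + j) [0..<k - 2])" by simp
      also have "\<dots> = map ((!) xs) [j..<j + (k - 2)]" by (simp only: map_add_upt add.commute)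
      finally have "set ?m = set (map ((!) xs) [j..<j + (k - 2)])" by (rule arg_cong)
      then show ?thesis by simp
    qed
    have "?x \<notin> set ?m" "?y \<notin> set ?m" 
      unfolding sm hx hy using True k len j xs(1) by (auto simp: nth_eq_iff_index_eq)
    moreover have "?x \<noteq> ?y" using xs(4) irr by metis
    ultimately have "distinct ?c" using xs(1) by simp
    moreover have "successively E ?m"
      using xs(3) nth lm unfolding successively_conv_nth by (auto simp: len)
    then have "successively E ?c" using hm mn j sym
      by (auto simp: successively_Cons successively_append_iff)
    moreover have "set ?c \<subseteq> V" using xs(2) ne by (auto dest: in_set_takeD in_set_dropD)
    ultimately have "is_cycle V E ?c" using k lm xs(4) by (intro is_cycleI) auto
    then show ?thesis using lm k by (intro exI[of _ ?c]) auto
  next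
    case False
    \<comment> \<open>The stretch would now run into \<open>?y\<close>. Instead the cycle descends
      from position \<open>i\<close> to \<open>0\<close>, jumps to \<open>j\<close>, climbs to
      \<open>?y\<close> and returns to \<open>i\<close>: \<open>(i + 1) + (n - j) = k\<close>
      vertices.\<close>
    define i where "i = f j"
    have i: "i = j + k - ?n - 1" "i \<le> j" "i < ?n" "i + 1 \<le> j" "1 \<le> i"
      using False len j k unfolding i_def f_def by auto
    let ?a = "take (Suc i) xs" and ?b = "drop j xs"
    let ?c = "rev ?a @ ?b"
    have n0: "?a \<noteq> []" "?b \<noteq> []" using ne j len c3 by auto
    have e: "hd ?a = ?x" "last ?a = xs ! i" "hd ?b = xs ! j" "last ?b = ?y"
      using i j n0 by (simp_all add: hd_take hd_drop_conv_nth) (simp add: take_Suc_conv_app_nth)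
    have "successively E (?a @ drop (Suc i) xs)" "successively E (take j xs @ ?b)" using xs by simp_all
    then have s: "successively E ?a" "successively E ?b" unfolding successively_append_iff by auto
    have "successively E ?c"
      using s e j sym n0 unfolding successively_append_iff successively_rev_sym by (simp add: last_rev)
    moreover have "E (last ?c) (hd ?c)" using n0 e j by (simp add: hd_rev i_def)
    moreover have "distinct ?c"
      using xs(1) i set_take_disj_set_drop_if_distinct[of xs "Suc i" j] by auto
    moreover have "length ?c = k" using i j len False k by auto
    moreover have "set ?c \<subseteq> V" using xs(2) by (auto dest: in_set_takeD in_set_dropD)
    ultimately show ?thesis using k by (intro exI[of _ ?c] conjI is_cycleI) auto
  qed
qed

end

section \<open>Light pairs\<close>

locale two_connected_graph = simple_graph +
  assumes card3: "3 \<le> card V"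
    and cut0: "\<lbrakk>S \<subseteq> V; S \<noteq> {}; S \<noteq> V\<rbrakk> \<Longrightarrow> \<exists>x\<in>S. \<exists>y\<in>V - S. E x y"
    and cut1: "\<lbrakk>z \<in> V; S \<subseteq> V - {z}; S \<noteq> {}; S \<noteq> V - {z}\<rbrakk> \<Longrightarrow> \<exists>x\<in>S. \<exists>y\<in>V - {z} - S. E x y"
begin

text \<open>As degrees are integers, this negates \<open>degree V E x \<ge> (n + 1) / 2\<close>. So
  an f1-heavy subgraph is one without two light vertices at distance 2.\<close>

definition light :: "'a \<Rightarrow> bool" where
  "light x \<longleftrightarrow> x \<in> V \<and> 2 * degree V E x \<le> card V"

definition heavy :: "'a \<Rightarrow> bool" where
  "heavy x \<longleftrightarrow> x \<in> V \<and> card V < 2 * degree V E x"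

lemma heavy_or_light: "x \<in> V \<Longrightarrow> heavy x \<longleftrightarrow> \<not> light x"
  unfolding light_def heavy_def by auto

definition light_pair :: "'a \<Rightarrow> 'a \<Rightarrow> 'a \<Rightarrow> bool" where
  "light_pair u v w \<longleftrightarrow> light u \<and> light v \<and> u \<noteq> v \<and> \<not> E u v \<and> E u w \<and> E v w"

lemma light_pair_sym: "light_pair u v w \<Longrightarrow> light_pair v u w"
  unfolding light_pair_def using sym by blast

end

locale claw_Z1_heavy = two_connected_graph +
  assumes nbr: "\<lbrakk>light_pair u v w; E w x; x \<noteq> u; x \<noteq> v\<rbrakk> \<Longrightarrow> E u x \<and> E v x"
    \<comment> \<open>Excludes only \<open>K\<^sub>4\<close> minus an edge and \<open>C\<^sub>4\<close>, see \<open>common_nbrs_cover\<close>.\<close>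
    and far: "light_pair u v w \<Longrightarrow> \<exists>r\<in>V. r \<noteq> u \<and> r \<noteq> v \<and> \<not> (E u r \<and> E v r)"
begin

lemma nbr_cases:
  assumes "light_pair u v w" "E w x"
  shows "x = u \<or> x = v \<or> (E u x \<and> E v x)"
  using nbr[OF assms] by blast

text \<open>By \<open>far\<close>, \<open>u\<close> and the common neighbours do not exhaust
  \<open>V - {v}\<close>, so after deleting \<open>v\<close> an edge leaves this set. It starts at
  \<open>u\<close>: by \<open>nbr\<close>, common neighbours are adjacent only to \<open>u\<close>,
  \<open>v\<close> and further common neighbours.\<close>

lemma out_nbr:
  assumes p: "light_pair u v w"
  shows "\<exists>r. E u r \<and> \<not> E v r"
proof -
  let ?S = "insert u {x. E u x \<and> E v x}"
  have "?S \<subseteq> V - {v}" "v \<in> V" using p inV irr unfolding light_pair_def light_def by blast+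
  moreover have "?S \<noteq> V - {v}" using far[OF p] by blast
  ultimately obtain x y where xy: "x \<in> ?S" "y \<in> V - {v} - ?S" "E x y" using cut1[of v ?S] by blast
  have "x = u"
  proof (rule ccontr)
    assume "x \<noteq> u"
    then have "light_pair u v x" using xy p unfolding light_pair_def by blast
    then show False using nbr_cases[OF _ xy(3)] xy(2) by blast
  qed
  then show ?thesis using xy by blast
qed

text \<open>Besides \<open>u\<close> and \<open>v\<close>, \<open>w\<close> sees only other common
  neighbours, whereas \<open>u\<close> sees all of them, \<open>w\<close> itself and the extra
  vertex \<open>r\<close>. Hence the degree of \<open>w\<close> is at most that of
  \<open>u\<close>.\<close>

lemma common_nbr_light:
  assumes p: "light_pair u v w"
  shows "light w"
proof -
  obtain r where r: "E u r" "\<not> E v r" using out_nbr[OF p] by blast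
  let ?C = "{x. E u x \<and> E v x}"
  have finC: "finite ?C" by simp
  have wC: "w \<in> ?C" using p unfolding light_pair_def by blast
  have "{x. E w x} \<subseteq> insert u (insert v (?C - {w}))" using nbr_cases[OF p] irr by blast
  then have "degree V E w \<le> card (insert u (insert v (?C - {w})))"
    unfolding degree_eq by (intro card_mono) (use finC in auto)
  also have "\<dots> \<le> Suc (Suc (card (?C - {w})))"
    using card_insert_le_m1 finC by (simp add: card_insert_if)
  also have "\<dots> = Suc (card ?C)" using card_Suc_Diff1[OF finC wC] by simp
  also have "\<dots> = card (insert r ?C)" using r finC by simp
  also have "\<dots> \<le> degree V E u" unfolding degree_eq by (intro card_mono) (use r in auto)
  finally show ?thesis using p inV unfolding light_pair_def light_def by force
qed

lemma heavy_light_nbrs_clique: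
  assumes "heavy h" "light u" "light v" "u \<noteq> v" "E h u" "E h v"
  shows "E u v"
proof (rule ccontr)
  assume "\<not> E u v"
  then have "light_pair u v h" using assms sym unfolding light_pair_def by blast
  then show False using common_nbr_light assms(1) heavy_or_light unfolding heavy_def by blast
qed

text \<open>If nonadjacent, \<open>w\<close> and \<open>w'\<close> would be a light pair at
  \<open>u\<close>. A neighbour \<open>r\<close> of \<open>u\<close> that is not adjacent to
  \<open>v\<close> would then be adjacent to \<open>w\<close>, and the pair \<open>u\<close>,
  \<open>v\<close> would force \<open>r\<close> to be adjacent to \<open>v\<close>.\<close>

lemma common_nbrs_clique:
  assumes p: "light_pair u v w" and w': "E u w'" "E v w'" "w \<noteq> w'"
  shows "E w w'"
proof (rule ccontr)
  assume n: "\<not> E w w'"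
  have p': "light_pair u v w'" using p w' unfolding light_pair_def by blast
  have q: "light_pair w w' u"
    using p w' n common_nbr_light[OF p] common_nbr_light[OF p'] sym unfolding light_pair_def by blast
  obtain r where r: "E u r" "\<not> E v r" using out_nbr[OF p] by blast
  have "E w r" using nbr_cases[OF q r(1)] r(2) p w' unfolding light_pair_def by blast
  then show False using nbr_cases[OF p] r p irr unfolding light_pair_def by blast
qed

text \<open>\<open>w\<close> and \<open>r\<close> are a light pair at \<open>u\<close>, so a third
  neighbour \<open>x\<close> of \<open>u\<close> is adjacent to both. Through \<open>w\<close>,
  \<open>x\<close> is a common neighbour of \<open>u\<close> and \<open>v\<close>, and then its
  neighbour \<open>r\<close> would have to be adjacent to \<open>v\<close>.\<close>

lemma light_out_nbr_degree2:
  assumes p: "light_pair u v w" and r: "E u r" "\<not> E v r" "light r"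
  shows "{x. E u x} = {w, r}"
proof -
  have nwr: "\<not> E w r"
    using nbr_cases[OF p] r irr p unfolding light_pair_def by blast
  have "w \<noteq> r" using p r unfolding light_pair_def by blast
  then have q: "light_pair w r u"
    using nwr p r common_nbr_light[OF p] sym unfolding light_pair_def by blast
  have "x = w \<or> x = r" if x: "E u x" for x
  proof (rule ccontr)
    assume "\<not> (x = w \<or> x = r)"
    then have x': "E w x" "E r x" using nbr_cases[OF q x] by auto
    then have "E v x" using nbr_cases[OF p x'(1)] r x p irr sym unfolding light_pair_def by blast
    then have "light_pair u v x" using p x unfolding light_pair_def by blast
    then show False using nbr_cases[of u v x r] x' r sym irr p unfolding light_pair_def by blast
  qed
  then show ?thesis using p r unfolding light_pair_def by blast
qed

lemma all_light_two_regular: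
  assumes all: "\<And>x. x \<in> V \<Longrightarrow> light x" and u: "u \<in> V"
  shows "card {x. E u x} = 2"
proof -
  obtain v w where p: "light_pair u v w"
  proof -
    \<comment> \<open>A light vertex cannot be adjacent to all others, so an edge leaving its closed
      neighbourhood leads to a vertex at distance 2.\<close>
    let ?S = "insert u {x. E u x}"
    have "?S \<noteq> V"
    proof
      assume "?S = V"
      then have "card V = Suc (degree V E u)" unfolding degree_eq
        using card_insert_disjoint[of "{x. E u x}" u] irr by (metis finite_nbrs mem_Collect_eq)
      then show False using all[OF u] card3 unfolding light_def by linarith
    qed
    then obtain w v where wv: "w \<in> ?S" "v \<in> V - ?S" "E w v"
      using cut0[of ?S] u inV by blast
    then have "E u w" by blast
    then have "light_pair u v w" using wv all u sym unfolding light_pair_def by blast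
    then show ?thesis using that by blast
  qed
  obtain r where r: "E u r" "\<not> E v r" using out_nbr[OF p] by blast
  have "light r" using all r inV by blast
  moreover have "w \<noteq> r" using r p unfolding light_pair_def by blast
  ultimately show ?thesis using light_out_nbr_degree2[OF p r] by simp
qed

end

section \<open>Connected 2-regular graphs are cycles\<close>

context two_connected_graph
begin

text \<open>On a longest path, the second neighbour of the last vertex is on the path; it must be
  the first vertex, as an inner one would get a third neighbour. No edge can leave the cycle so
  closed.\<close>

lemma two_regular_cycle_graph:
  assumes reg: "\<And>x. x \<in> V \<Longrightarrow> card {y. E x y} = 2"
  shows "is_cycle_graph V E"
proof -
  let ?P = "\<lambda>p. p \<noteq> [] \<and> distinct p \<and> set p \<subseteq> V \<and> successively E p"
  have no3: False if "E x a" "E x b" "E x c" "a \<noteq> b" "a \<noteq> c" "b \<noteq> c" for x a b c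
  proof -
    have "card {a, b, c} \<le> card {y. E x y}" by (rule card_mono) (use that in auto)
    then show False using reg[of x] inV that by force
  qed
  have two: "\<exists>y. E x y \<and> y \<noteq> a" if "x \<in> V" for x a
  proof (rule ccontr)
    assume "\<not> ?thesis"
    then have "card {y. E x y} \<le> card {a}" by (intro card_mono) auto
    then show False using reg[OF that] by simp
  qed
  obtain z where "z \<in> V" using card3 by fastforce
  then have ex: "?P [z]" by simp
  have bnd: "\<forall>q. ?P q \<longrightarrow> length q < Suc (card V)"
    using card_mono[OF fin] by (metis (no_types, lifting) distinct_card le_imp_less_Suc)
  obtain p where p: "?P p" and "\<forall>q. ?P q \<longrightarrow> length q \<le> length p"
    using ex_has_greatest_nat[OF ex bnd] by blast
  then have mx: "\<And>q. ?P q \<Longrightarrow> length q \<le> length p" by blast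
  let ?n = "length p"
  have nth: "E (p ! i) (p ! Suc i)" if "Suc i < ?n" for i
    using p that unfolding successively_conv_nth by blast
  have inp: "y \<in> set p" if "E (last p) y" for y
  proof (rule ccontr)
    assume "y \<notin> set p"
    then have "?P (p @ [y])" using p that inV by (auto simp: successively_append_iff)
    then show False using mx[of "p @ [y]"] by simp
  qed
  have lastV: "last p \<in> V" and hl: "hd p = p ! 0" "last p = p ! (?n - 1)"
    using p by (auto simp: hd_conv_nth last_conv_nth)
  obtain y where y: "E (last p) y" "y \<noteq> p ! (?n - 2)" using two[OF lastV] by blast
  then obtain j where j: "j < ?n" "y = p ! j" using inp by (metis in_set_conv_nth)
  have jn: "j \<noteq> ?n - 1" "j \<noteq> ?n - 2" using y irr hl j by auto
  have "j = 0"
  proof (rule ccontr)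
    assume "j \<noteq> 0"
    then obtain i where i: "j = Suc i" by (cases j) auto
    have "E (p ! j) (p ! i)" "E (p ! j) (p ! Suc j)" "E (p ! j) (last p)"
      using nth[of i] nth[of j] i j jn y sym by auto
    moreover have "p ! i \<noteq> p ! Suc j" "p ! i \<noteq> last p" "p ! Suc j \<noteq> last p"
      using p i j jn unfolding hl by (simp_all add: nth_eq_iff_index_eq)
    ultimately show False by (rule no3)
  qed
  then have close: "E (last p) (hd p)" and n3: "3 \<le> ?n" using y j jn hl by auto
  have cyc: "is_cycle V E p" using p close n3 by (intro is_cycleI) auto
  have step: "E (p ! i) (p ! ((i + 1) mod ?n))" if "i < ?n" for i
    using cyc that unfolding is_cycle_def by blast
  have nb: "y = p ! ((i + 1) mod ?n) \<or> (\<exists>k<?n. y = p ! k \<and> i = (k + 1) mod ?n)"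
    if i: "i < ?n" and y: "E (p ! i) y" for i y
  proof -
    define k where "k = (if i = 0 then ?n - 1 else i - 1)"
    have k: "k < ?n" "i = (k + 1) mod ?n" using i n3 unfolding k_def by auto
    have "k \<noteq> (i + 1) mod ?n"
    proof (cases "i = ?n - 1")
      case False
      then show ?thesis using i n3 by (auto simp: k_def)
    next
      case True
      then have "i + 1 = ?n" using n3 by simp
      then have "(i + 1) mod ?n = 0" by simp
      then show ?thesis using True n3 by (simp add: k_def)
    qed
    moreover have "(i + 1) mod ?n < ?n" by (rule mod_less_divisor) (use n3 in linarith)
    ultimately have "p ! k \<noteq> p ! ((i + 1) mod ?n)" using p k(1) by (simp add: nth_eq_iff_index_eq)
    moreover have "E (p ! i) (p ! k)" using step[OF k(1)] k(2) sym by simp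
    ultimately show ?thesis using no3[OF y _ step[OF i]] k by blast
  qed
  have "set p = V"
  proof (rule ccontr)
    assume "set p \<noteq> V"
    then obtain x y where xy: "x \<in> set p" "y \<in> V - set p" "E x y" using cut0[of "set p"] p by auto
    then obtain i where "i < ?n" "x = p ! i" by (metis in_set_conv_nth)
    moreover have "(i + 1) mod ?n < ?n" by (rule mod_less_divisor) (use n3 in linarith)
    ultimately have "y \<in> set p" using nb[of i y] xy(3) nth_mem by blast
    then show False using xy by blast
  qed
  moreover have "\<exists>i<?n. {x, y} = {p ! i, p ! ((i + 1) mod ?n)}" if e: "E x y" for x y
  proof -
    obtain i where i: "i < ?n" "x = p ! i" using \<open>set p = V\<close> inV[OF e] by (metis in_set_conv_nth)
    then show ?thesis using nb[of i y] e by (metis insert_commute)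
  qed
  ultimately show ?thesis unfolding is_cycle_graph_def using cyc by blast
qed


end

section \<open>Components of light vertices\<close>

context two_connected_graph
begin

definition light_path :: "'a list \<Rightarrow> bool" where
  "light_path p \<longleftrightarrow> p \<noteq> [] \<and> distinct p \<and> successively E p \<and> (\<forall>x\<in>set p. light x)"

definition light_closed :: "'a set \<Rightarrow> bool" where
  "light_closed S \<longleftrightarrow> (\<forall>x\<in>S. \<forall>y. E x y \<and> light y \<longrightarrow> y \<in> S)"

text \<open>\<open>set p\<close> is the vertex set of a whole light component, ready to be inserted
  between \<open>a\<close> and \<open>b\<close>. If \<open>p\<close> has one vertex, both are
  attached to it.\<close>

definition block :: "'a list \<Rightarrow> 'a \<Rightarrow> 'a \<Rightarrow> bool" where
  "block p a b \<longleftrightarrow> light_path p \<and> light_closed (set p) \<and> heavy a \<and> heavy b \<and> a \<noteq> b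
     \<and> E a (hd p) \<and> E b (last p)"

text \<open>A segment is a non-clique (part of a) light component that can only be left at its ends.\<close>

definition segment :: "'a list \<Rightarrow> bool" where
  "segment p \<longleftrightarrow> light_path p \<and> 3 \<le> length p \<and> \<not> E (hd p) (last p)
     \<and> (\<forall>x\<in>set p. x \<noteq> hd p \<longrightarrow> x \<noteq> last p \<longrightarrow> (\<forall>y. E x y \<longrightarrow> y \<in> set p))"

definition light_edges :: "('a \<times> 'a) set" where
  "light_edges = {(x, y). light x \<and> light y \<and> E x y}"

lemma light_path_rev: "light_path (rev p) \<longleftrightarrow> light_path p"
  unfolding light_path_def successively_rev_sym by simp

lemma segment_rev: "segment p \<Longrightarrow> segment (rev p)"
  unfolding segment_def light_path_rev using sym
  by (metis (no_types, lifting) hd_rev last_rev length_rev set_rev)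

lemma light_closed_rtrancl:
  assumes "light_closed S" "(x, y) \<in> light_edges\<^sup>*" "x \<in> S"
  shows "y \<in> S"
  using assms(2,3)
proof (induction rule: rtrancl_induct)
  case (step y z)
  then show ?case using assms(1) unfolding light_closed_def light_edges_def by blast
qed

lemma light_edges_rtrancl_sym: "(x, y) \<in> light_edges\<^sup>* \<Longrightarrow> (y, x) \<in> light_edges\<^sup>*"
proof -
  have "sym light_edges" unfolding sym_def light_edges_def using sym by blast
  then show "(x, y) \<in> light_edges\<^sup>* \<Longrightarrow> (y, x) \<in> light_edges\<^sup>*"
    by (meson sym_rtrancl symD)
qed

text \<open>Along a walk of light vertices from \<open>x\<close>, the first one not adjacent to
  \<open>x\<close> would form a light pair with \<open>x\<close> at its predecessor.\<close>

lemma light_component_clique: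
  assumes none: "\<And>v w. \<not> light_pair x v w" and xy: "(x, y) \<in> light_edges\<^sup>*"
  shows "y = x \<or> E x y"
  using xy
proof (induction rule: rtrancl_induct)
  case (step y z)
  then have yz: "light y" "light z" "E y z" unfolding light_edges_def by auto
  show ?case
  proof (rule ccontr)
    assume n: "\<not> (z = x \<or> E x z)"
    then have "y \<noteq> x" using yz by blast
    then have "E x y" using step by blast
    moreover have "light x"
      using step.hyps(1) yz(1) unfolding light_edges_def by (induction rule: converse_rtrancl_induct) auto
    ultimately show False using none[of z y] n yz sym unfolding light_pair_def by blast
  qed
qed simp

lemma clique_hamiltonian_path:
  assumes "finite D" "\<And>x y. x \<in> D \<Longrightarrow> y \<in> D \<Longrightarrow> x \<noteq> y \<Longrightarrow> E x y"
    and st: "s \<in> D" "t \<in> D" "s \<noteq> t \<or> D = {s}"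
  shows "\<exists>p. p \<noteq> [] \<and> distinct p \<and> successively E p \<and> set p = D \<and> hd p = s \<and> last p = t"
proof (cases "D = {s}")
  case True
  then show ?thesis using st by (intro exI[of _ "[s]"]) auto
next
  case False
  obtain xs where xs: "set xs = D - {s, t}" "distinct xs"
    using assms(1) finite_distinct_list by (metis finite_Diff)
  let ?p = "s # xs @ [t]"
  have d: "distinct ?p" "set ?p = D" using xs st False by auto
  moreover have "successively E ?p" by (rule successively_clique[OF d(1)]) (use d assms in blast)
  ultimately show ?thesis by (intro exI[of _ ?p]) auto
qed

text \<open>A clique has a Hamiltonian path between any two of its vertices, so two disjoint edges
  leaving \<open>D\<close> suffice (for a singleton \<open>D\<close>, two edges). Their outer ends
  are heavy because \<open>D\<close> is light-closed.\<close>

lemma clique_block: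
  assumes D: "light_closed D" "D \<noteq> {}" "\<And>x. x \<in> D \<Longrightarrow> light x"
    and cl: "\<And>x y. x \<in> D \<Longrightarrow> y \<in> D \<Longrightarrow> x \<noteq> y \<Longrightarrow> E x y"
    and h: "heavy h"
  shows "\<exists>p a b. block p a b \<and> set p = D"
proof -
  have DV: "D \<subseteq> V" using D unfolding light_def by blast
  have out: "heavy y" if "E x y" "x \<in> D" "y \<notin> D" for x y
    using that D inV heavy_or_light unfolding light_closed_def by blast
  have "h \<notin> D" "h \<in> V" using h D heavy_or_light unfolding heavy_def by blast+
  then obtain d a where da: "d \<in> D" "a \<notin> D" "E d a" using cut0[of D] D DV by blast
  have aV: "a \<in> V" "a \<noteq> d" using inV da by blast+
  have "\<exists>s t a b. s \<in> D \<and> t \<in> D \<and> (s \<noteq> t \<or> D = {s}) \<and> a \<noteq> b \<and> a \<notin> D \<and> b \<notin> D \<and> E s a \<and> E t b"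
  proof (cases "D = {d}")
    case True
    have "{d} \<noteq> V - {a}"
    proof
      assume "{d} = V - {a}"
      then have "V = {a, d}" using aV by blast
      then show False using card3 card_insert_le_m1[of 2 "{d}" a] by (auto simp: card_insert_if split: if_splits)
    qed
    then obtain b where "b \<in> V - {a} - {d}" "E d b" using cut1[of a "{d}"] aV DV True by blast
    then show ?thesis using True da by blast
  next
    case False
    \<comment> \<open>Deleting \<open>d\<close> yields a second leaving edge, at another vertex of
      \<open>D\<close>. If it also ends in \<open>a\<close>, deleting \<open>a\<close> yields a
      third one, disjoint from one of the first two.\<close>
    have "D - {d} \<noteq> V - {d}" "D - {d} \<subseteq> V - {d}" "D - {d} \<noteq> {}" "d \<in> V" using aV da DV False by blast+
    then obtain d' a' where d': "d' \<in> D - {d}" "a' \<in> V - {d} - (D - {d})" "E d' a'"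
      using cut1[of d "D - {d}"] by blast
    show ?thesis
    proof (cases "a = a'")
      case False
      then show ?thesis using d' da by blast
    next
      case True
      have "D \<noteq> V - {a}"
      proof
        assume "D = V - {a}"
        then have "insert d {y. E d y} = V" using cl da inV by blast
        then have "card V = Suc (degree V E d)" unfolding degree_eq
          using card_insert_disjoint[of "{y. E d y}" d] irr by (metis finite_nbrs mem_Collect_eq)
        then show False using D(3)[OF da(1)] card3 unfolding light_def by linarith
      qed
      then obtain e b where e: "e \<in> D" "b \<in> V - {a} - D" "E e b"
        using cut1[of a D] D DV da aV by blast
      show ?thesis
      proof (cases "e = d")
        case True
        then show ?thesis using e d' da \<open>a = a'\<close> by blast
      next
        case False
        then show ?thesis using e da by blast
      qed
    qed
  qed
  then obtain s t a b where st: "s \<in> D" "t \<in> D" "s \<noteq> t \<or> D = {s}" "a \<noteq> b" "a \<notin> D" "b \<notin> D" "E s a" "E t b"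
    by blast
  have "finite D" using DV fin finite_subset by blast
  then obtain p where p: "p \<noteq> []" "distinct p" "successively E p" "set p = D" "hd p = s" "last p = t"
    using clique_hamiltonian_path[of D s t] cl st by blast
  have "block p a b" unfolding block_def light_path_def
    using p D st out sym by simp
  then show ?thesis using p by blast
qed

end

section \<open>Light components that contain a light pair\<close>

context claw_Z1_heavy
begin

text \<open>The common neighbours form a clique, so they can be listed in any order between
  \<open>u\<close> and \<open>v\<close>; by \<open>nbr_cases\<close> they have no neighbours
  elsewhere.\<close>

lemma light_pair_segment:
  assumes p: "light_pair u v w"
  shows "\<exists>p. segment p \<and> hd p = u \<and> last p = v"
proof -
  let ?C = "{x. E u x \<and> E v x}"
  have uv: "light u" "light v" "u \<noteq> v" "\<not> E u v" "E u w" "E v w"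
    using p unfolding light_pair_def by auto
  have C: "light_pair u v x" if "x \<in> ?C" for x using that uv unfolding light_pair_def by blast
  have "finite ?C" by simp
  then obtain xs where xs: "set xs = ?C" "distinct xs" using finite_distinct_list by blast
  have "w \<in> set xs" using xs(1) uv by simp
  then have ne: "xs \<noteq> []" by auto
  have cl: "E x y" if "x \<in> ?C" "y \<in> ?C" "x \<noteq> y" for x y
    using common_nbrs_clique[OF C[OF that(1)]] that by blast
  have "successively E xs"
    by (rule successively_clique[OF xs(2)]) (unfold xs(1), rule cl)
  moreover have "hd xs \<in> ?C" "last xs \<in> ?C"
    using hd_in_set[OF ne] last_in_set[OF ne] unfolding xs(1) by blast+
  ultimately have succ: "successively E (u # xs @ [v])"
    using ne sym[of v "last xs"] by (simp add: successively_Cons successively_append_iff)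
  let ?p = "u # xs @ [v]"
  have "distinct ?p" using xs uv irr by auto
  moreover have "\<forall>x\<in>set ?p. light x"
    using uv(1,2) common_nbr_light[OF C] by (simp add: xs(1))
  moreover have "3 \<le> length ?p" using ne by (cases xs) auto
  moreover have "\<forall>x\<in>set ?p. x \<noteq> u \<longrightarrow> x \<noteq> v \<longrightarrow> (\<forall>y. E x y \<longrightarrow> y \<in> set ?p)"
    using nbr_cases[OF C] by (simp add: xs(1))
  ultimately have "segment ?p" unfolding segment_def light_path_def using succ uv by simp
  then show ?thesis by (intro exI[of _ ?p]) auto
qed

lemma segment_ends:
  assumes "segment p"
  shows "p \<noteq> []" "hd p \<in> set p" "last p \<in> set p" "hd p \<noteq> last p" "light (hd p)" "light (last p)"
    "set p \<subseteq> V"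
proof -
  show ne: "p \<noteq> []" and i: "hd p \<in> set p" "last p \<in> set p"
    using assms unfolding segment_def light_path_def by auto
  show "light (hd p)" "light (last p)" "set p \<subseteq> V"
    using assms i unfolding segment_def light_path_def light_def by auto
  show "hd p \<noteq> last p"
    using assms ne unfolding segment_def light_path_def
    by (auto simp: hd_conv_nth last_conv_nth nth_eq_iff_index_eq)
qed

lemma segment_internal:
  assumes "segment p" "x \<in> set p" "x \<noteq> hd p" "x \<noteq> last p" "E x y"
  shows "y \<in> set p"
  using assms unfolding segment_def by blast

text \<open>After deleting \<open>hd p\<close>, some edge leaves the rest of the segment, and it can
  only start at \<open>last p\<close>. The vertex \<open>h\<close> witnesses that the segment is not
  all of \<open>V\<close>.\<close>

lemma segment_exit:
  assumes p: "segment p" and h: "heavy h"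
  shows "\<exists>r. E (last p) r \<and> r \<notin> set p"
proof -
  note e = segment_ends[OF p]
  let ?S = "set p - {hd p}"
  have "h \<notin> set p" using p h heavy_or_light unfolding segment_def light_path_def heavy_def by blast
  moreover have "h \<in> V" "h \<noteq> hd p" using h calculation e unfolding heavy_def by auto
  ultimately have "?S \<noteq> V - {hd p}" by blast
  moreover have "?S \<subseteq> V - {hd p}" "?S \<noteq> {}" "hd p \<in> V" using e(2,3,4,7) by auto
  ultimately have "\<exists>x\<in>?S. \<exists>y\<in>V - {hd p} - ?S. E x y" by (intro cut1)
  then obtain x y where xy: "x \<in> ?S" "y \<in> V - {hd p} - ?S" "E x y" by blast
  then have "x = last p" using segment_internal[OF p] by blast
  then show ?thesis using xy by blast
qed

text \<open>The old end \<open>last p\<close> becomes an inner vertex, so its neighbours must be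
  just its predecessor \<open>w\<close> and \<open>r\<close>; and the new end \<open>r\<close> must
  not be adjacent to \<open>hd p\<close>.\<close>

lemma segment_extend:
  assumes p: "segment p" and h: "heavy h" and r: "E (last p) r" "r \<notin> set p" "light r"
  shows "segment (p @ [r])"
proof -
  note e = segment_ends[OF p]
  let ?u = "hd p" and ?v = "last p"
  define w where "w = p ! (length p - 2)"
  have len: "3 \<le> length p" and nuv: "\<not> E ?u ?v" and dp: "distinct p" and sp: "successively E p"
    and lp: "\<And>x. x \<in> set p \<Longrightarrow> light x"
    using p unfolding segment_def light_path_def by auto
  have w: "w \<in> set p" "w \<noteq> ?u" "w \<noteq> ?v" "E w ?v"
  proof -
    show "w \<in> set p" unfolding w_def using len by (intro nth_mem) linarith
    have "length p - 2 < length p" "0 < length p" "length p - 1 < length p" using len by linarith+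
    then show "w \<noteq> ?u" "w \<noteq> ?v" unfolding w_def hd_conv_nth[OF e(1)] last_conv_nth[OF e(1)]
      using len dp nth_eq_iff_index_eq by fastforce+
    have "Suc (length p - 2) = length p - 1" using len by simp
    then show "E w ?v" unfolding w_def last_conv_nth[OF e(1)]
      using successively_nth[OF sp, of "length p - 2"] len by simp
  qed
  have nwr: "\<not> E w r" using segment_internal[OF p w(1-3)] r by blast
  have q: "light_pair w r ?v"
    using nwr w r lp sym unfolding light_pair_def by blast
  \<comment> \<open>A third neighbour \<open>x\<close> would be adjacent to both \<open>w\<close>
    and \<open>r\<close>. Adjacency to \<open>w\<close> makes \<open>x\<close> an inner vertex of
    the segment, which cannot be adjacent to \<open>r\<close>.\<close>
  have Nv: "x = w \<or> x = r" if x: "E ?v x" for x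
  proof (rule ccontr)
    assume "\<not> (x = w \<or> x = r)"
    then have x': "E w x" "E r x" using nbr_cases[OF q x] by auto
    have "x \<in> set p" using segment_internal[OF p w(1-3) x'(1)] .
    moreover have "x \<noteq> ?u" "x \<noteq> ?v" using x nuv sym irr by blast+
    ultimately show False using segment_internal[OF p, of x r] x' r sym by blast
  qed
  \<comment> \<open>Otherwise \<open>r\<close> and \<open>?v\<close> would have no neighbours
    outside the segment and \<open>r\<close>, and \<open>?u\<close> would separate the rest of these
    vertices from \<open>h\<close>.\<close>
  have "\<not> E ?u r"
  proof
    assume "E ?u r"
    then have lp': "light_pair ?u ?v r" using e nuv r unfolding light_pair_def by blast
    have Nr: "y = ?u \<or> y = ?v" if "E r y" for y
      using nbr_cases[OF lp' that] Nv[of y] nwr that sym irr by blast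
    let ?S = "insert r (set p) - {?u}"
    have "h \<notin> insert r (set p)" using r lp h heavy_or_light unfolding heavy_def by blast
    then have "?S \<noteq> V - {?u}" using h e unfolding heavy_def by blast
    moreover have "?S \<subseteq> V - {?u}" "?S \<noteq> {}" "?u \<in> V" using e(2,3,4,7) inV[OF r(1)] by auto
    ultimately have "\<exists>x\<in>?S. \<exists>y\<in>V - {?u} - ?S. E x y" by (intro cut1)
    then obtain x y where xy: "x \<in> ?S" "y \<in> V - {?u} - ?S" "E x y" by blast
    then have "x = r \<or> x = ?v" using segment_internal[OF p] by blast
    then show False
    proof
      assume "x = r"
      then show False using Nr[of y] xy e by blast
    next
      assume "x = ?v"
      then show False using Nv[of y] xy w r by blast
    qed
  qed
  moreover have "y \<in> set (p @ [r])" if "x \<in> set (p @ [r])" "x \<noteq> ?u" "x \<noteq> r" "E x y" for x y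
  proof (cases "x = ?v")
    case True
    then show ?thesis using Nv[of y] that w by auto
  next
    case False
    then show ?thesis using segment_internal[OF p, of x y] that by auto
  qed
  ultimately show ?thesis
    unfolding segment_def light_path_def
    using e len dp sp lp r by (auto simp: successively_append_iff)
qed

text \<open>A longest segment containing \<open>p\<close> cannot be extended at its last vertex or,
  by reversal, at its first, and its inner vertices have no outside neighbours.\<close>

lemma maximal_segment:
  assumes p: "segment p" and h: "heavy h"
  shows "\<exists>q. segment q \<and> set p \<subseteq> set q \<and> light_closed (set q)"
proof -
  let ?P = "\<lambda>q. segment q \<and> set p \<subseteq> set q"
  have bnd: "\<forall>q. ?P q \<longrightarrow> length q < Suc (card V)"
  proof (intro allI impI)
    fix q assume "?P q"
    then have "distinct q" "set q \<subseteq> V" using segment_ends unfolding segment_def light_path_def by auto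
    then show "length q < Suc (card V)" using card_mono[OF fin] by (metis distinct_card le_imp_less_Suc)
  qed
  have ex: "?P p" using p by blast
  obtain q where q: "?P q" and "\<forall>q'. ?P q' \<longrightarrow> length q' \<le> length q"
    using ex_has_greatest_nat[OF ex bnd] by blast
  then have mx: "\<And>q'. ?P q' \<Longrightarrow> length q' \<le> length q" by blast
  have lastc: "r \<in> set q'" if q': "?P q'" "length q' = length q" "E (last q') r" "light r" for q' r
  proof (rule ccontr)
    assume "r \<notin> set q'"
    then have "?P (q' @ [r])" using segment_extend[OF _ h, of q' r] q' by auto
    then show False using mx[of "q' @ [r]"] q' by simp
  qed
  have "y \<in> set q" if xy: "x \<in> set q" "E x y" "light y" for x y
  proof -
    consider "x = last q" | "x = hd q" | "x \<noteq> hd q" "x \<noteq> last q" by blast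
    then show ?thesis
    proof cases
      case 1
      then show ?thesis using lastc[of q y] q xy by blast
    next
      case 2
      then show ?thesis using lastc[of "rev q" y] segment_rev q xy segment_ends(1) by (auto simp: last_rev)
    next
      case 3
      then show ?thesis using segment_internal q xy by blast
    qed
  qed
  then show ?thesis using q unfolding light_closed_def by blast
qed

lemma light_pair_block:
  assumes uvw: "light_pair u v w" and h: "heavy h"
  shows "\<exists>p a b. segment p \<and> block p a b \<and> u \<in> set p"
proof -
  obtain p0 where "segment p0" "hd p0 = u" using light_pair_segment[OF uvw] by blast
  then obtain p where p: "segment p" "u \<in> set p" "light_closed (set p)"
    using maximal_segment[OF _ h, of p0] segment_ends(2) by blast
  note e = segment_ends[OF p(1)]
  obtain b where b: "E (last p) b" "b \<notin> set p" using segment_exit[OF p(1) h] by blast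
  obtain a where a: "E (hd p) a" "a \<notin> set p" 
    using segment_exit[OF segment_rev[OF p(1)] h] by (auto simp: last_rev)
  have hab: "heavy a" "heavy b" using a b e p(3) inV heavy_or_light unfolding light_closed_def by blast+
  \<comment> \<open>A common heavy neighbour would make the two ends of the segment
    adjacent.\<close>
  moreover have "a \<noteq> b"
  proof
    assume "a = b"
    then have "E (hd p) (last p)" using heavy_light_nbrs_clique[of a "hd p" "last p"] hab a b e sym by blast
    then show False using p unfolding segment_def by blast
  qed
  ultimately have "block p a b"
    using p a b sym unfolding block_def segment_def by blast
  then show ?thesis using p by blast
qed

lemma light_in_block:
  assumes x: "light x" and h: "heavy h"
  shows "\<exists>p a b. block p a b \<and> x \<in> set p"
proof -
  define D where "D = {y. (x, y) \<in> light_edges\<^sup>*}"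
  have lD: "light y" if "y \<in> D" for y
    using that x unfolding D_def light_edges_def by (auto elim: rtranclE)
  have closed: "light_closed D"
    unfolding light_closed_def
  proof (intro ballI allI impI)
    fix y z assume "y \<in> D" "E y z \<and> light z"
    then have "(y, z) \<in> light_edges" using lD unfolding light_edges_def by blast
    then show "z \<in> D" using \<open>y \<in> D\<close> unfolding D_def by (auto intro: rtrancl_into_rtrancl)
  qed
  show ?thesis
  proof (cases "\<exists>u\<in>D. \<exists>v w. light_pair u v w")
    case True
    then obtain u v w where u: "u \<in> D" "light_pair u v w" by blast
    then obtain p a b where p: "block p a b" "u \<in> set p" using light_pair_block[OF _ h] by blast
    have "(u, x) \<in> light_edges\<^sup>*" using u light_edges_rtrancl_sym unfolding D_def by blast
    then have "x \<in> set p" using light_closed_rtrancl p unfolding block_def by blast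
    then show ?thesis using p by blast
  next
    case False
    have "E y z" if "y \<in> D" "z \<in> D" "y \<noteq> z" for y z
    proof -
      have "(y, z) \<in> light_edges\<^sup>*"
        using that light_edges_rtrancl_sym unfolding D_def by (metis mem_Collect_eq rtrancl_trans)
      then show ?thesis using light_component_clique[of y z] False that by blast
    qed
    moreover have "x \<in> D" unfolding D_def by simp
    ultimately show ?thesis using clique_block[OF closed _ lD _ h] by blast
  qed
qed

section \<open>Hamiltonian cycles and their consecutive heavy vertices\<close>

lemma hamiltonian_with_heavy_clique:
  assumes h: "heavy h"
  shows "\<exists>q. hamiltonian_list V (\<lambda>x y. E x y \<or> (heavy x \<and> heavy y \<and> x \<noteq> y)) q"
proof -
  let ?E = "\<lambda>x y. E x y \<or> (heavy x \<and> heavy y \<and> x \<noteq> y)"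
  \<comment> \<open>A longest such path is shown to span \<open>V\<close>. Heavy ends allow
    appending through an added edge, and light-closedness means that each light component is taken
    entirely or not at all. The empty list is the starting point.\<close>
  let ?P = "\<lambda>q. distinct q \<and> set q \<subseteq> V \<and> successively ?E q \<and>
    (q \<noteq> [] \<longrightarrow> heavy (hd q) \<and> heavy (last q)) \<and> light_closed (set q)"
  have ex: "?P []" unfolding light_closed_def by simp
  have bnd: "\<forall>q. ?P q \<longrightarrow> length q < Suc (card V)"
    using card_mono[OF fin] by (metis (no_types, lifting) distinct_card le_imp_less_Suc)
  obtain q where q: "?P q" and "\<forall>q'. ?P q' \<longrightarrow> length q' \<le> length q"
    using ex_has_greatest_nat[OF ex bnd] by blast
  then have mx: "\<And>q'. ?P q' \<Longrightarrow> length q' \<le> length q" by blast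
  have lightq: "x \<in> set q" if x: "light x" for x
  proof (rule ccontr)
    assume xq: "x \<notin> set q"
    obtain p a b where p: "block p a b" "x \<in> set p" using light_in_block[OF x h] by blast
    have lp: "p \<noteq> []" "distinct p" "successively E p" "\<And>y. y \<in> set p \<Longrightarrow> light y" "light_closed (set p)"
      and ab: "heavy a" "heavy b" "a \<noteq> b" "E a (hd p)" "E b (last p)"
      using p unfolding block_def light_path_def by auto
    have disj: "set p \<inter> set q = {}"
    proof (rule ccontr)
      assume "set p \<inter> set q \<noteq> {}"
      then obtain y where "y \<in> set p" "y \<in> set q" by blast
      then have "set p \<subseteq> set q"
        using successively_subset_closed[OF lp(3) sym, of "set q"] q lp(4) unfolding light_closed_def by blast
      then show False using xq p by blast
    qed
    have hl: "hd p \<in> set p" "last p \<in> set p" using lp by auto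
    \<comment> \<open>If \<open>a\<close> or \<open>b\<close> were on \<open>q\<close>, so would be
      its light neighbour on \<open>p\<close>.\<close>
    have aq: "a \<notin> set q" "b \<notin> set q" "a \<notin> set p" "b \<notin> set p" "a \<in> V" "b \<in> V"
      using q ab disj hl lp(4) heavy_or_light unfolding light_closed_def heavy_def by blast+
    \<comment> \<open>Appending \<open>a\<close> and \<open>b\<close> keeps the path light-closed:
      the light neighbours of each form a clique that meets \<open>p\<close>.\<close>
    have nb: "y \<in> set p" if "E c y" "light y" "heavy c" "E c z" "z \<in> set p" for c y z
      using heavy_light_nbrs_clique[of c z y] that lp(4,5) unfolding light_closed_def by blast
    let ?q = "q @ a # p @ [b]"
    have "distinct ?q" using q lp aq ab disj by auto
    moreover have "set ?q \<subseteq> V" using q aq lp(4) unfolding light_def by auto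
    moreover have "successively ?E p" using lp(3) by (rule successively_mono) simp
    then have "successively ?E ?q"
      using q lp ab aq sym by (auto simp: successively_append_iff successively_Cons)
    moreover have "light_closed (set ?q)"
      using q lp(5) nb[of a _ "hd p"] nb[of b _ "last p"] ab hl unfolding light_closed_def by auto
    ultimately have "?P ?q" using q ab by (cases q) auto
    then show False using mx[of ?q] by simp
  qed
  have setq: "set q = V"
  proof (rule ccontr)
    assume "set q \<noteq> V"
    then obtain x where x: "x \<in> V" "x \<notin> set q" using q by blast
    then have hx: "heavy x" using lightq heavy_or_light by blast
    have "q = [] \<or> last q \<noteq> x" using x by auto
    then have "successively ?E (q @ [x])" using q hx by (auto simp: successively_append_iff)
    moreover have "heavy (hd (q @ [x]))" using q hx by (cases q) auto
    moreover have "light_closed (set (q @ [x]))" using lightq unfolding light_closed_def by simp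
    ultimately have "?P (q @ [x])" using q x hx by simp
    then show False using mx[of "q @ [x]"] by simp
  qed
  have len: "length q = card V" using q setq distinct_card by fastforce
  have "q \<noteq> []" using len card3 by auto
  moreover have "last q \<noteq> hd q"
    using q len card3 \<open>q \<noteq> []\<close> by (auto simp: hd_conv_nth last_conv_nth nth_eq_iff_index_eq)
  ultimately show ?thesis using q setq unfolding hamiltonian_list_def by blast
qed

lemma hamiltonian:
  assumes h: "heavy h"
  shows "\<exists>q. hamiltonian_list V E q"
proof -
  let ?F = "{(x, y). heavy x \<and> heavy y \<and> x \<noteq> y}"
  obtain q where "hamiltonian_list V (\<lambda>x y. E x y \<or> (heavy x \<and> heavy y \<and> x \<noteq> y)) q"
    using hamiltonian_with_heavy_clique[OF h] by blast
  moreover have "(\<lambda>x y. E x y \<or> (heavy x \<and> heavy y \<and> x \<noteq> y)) = (\<lambda>x y. E x y \<or> (x, y) \<in> ?F \<or> (y, x) \<in> ?F)"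
    by blast
  moreover have "finite ?F"
    by (rule finite_subset[of _ "V \<times> V"]) (use fin in \<open>auto simp: heavy_def\<close>)
  ultimately show ?thesis
    by (intro ore_closure[OF simple_graph_axioms card3 \<open>finite ?F\<close>]) (auto simp: heavy_def)
qed

text \<open>A heavy vertex between two light ones on the path makes these two adjacent.\<close>

lemma alternating_path:
  assumes "successively E (z # xs)" "successively (\<lambda>x y. \<not> (heavy x \<and> heavy y)) (z # xs)"
    "distinct (z # xs)" "set (z # xs) \<subseteq> V" "light z"
  shows "(\<forall>y\<in>set xs. light y \<longrightarrow> (z, y) \<in> light_edges\<^sup>*)
    \<and> length (filter heavy (z # xs)) \<le> length (filter light (z # xs))"
  using assms
proof (induction xs arbitrary: z rule: length_induct)
  case (1 xs)
  have zh: "\<not> heavy z" using 1 heavy_or_light by auto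
  show ?case
  proof (cases xs)
    case Nil
    then show ?thesis using 1 zh by simp
  next
    case (Cons y ys)
    show ?thesis
    proof (cases "light y")
      case True
      then have zy: "(z, y) \<in> light_edges" using 1 Cons unfolding light_edges_def by simp
      have "\<not> heavy y" using True 1 Cons heavy_or_light by auto
      moreover have "(\<forall>x\<in>set ys. light x \<longrightarrow> (y, x) \<in> light_edges\<^sup>*)
        \<and> length (filter heavy (y # ys)) \<le> length (filter light (y # ys))"
        using 1 Cons True by auto
      ultimately show ?thesis using zy zh 1(6) True Cons by (auto intro: converse_rtrancl_into_rtrancl)
    next
      case False
      then have hy: "heavy y" using 1 Cons heavy_or_light by auto
      show ?thesis
      proof (cases ys)
        case Nil
        then show ?thesis using Cons False hy zh 1(6) by simp
      next
        case (Cons w ws)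
        note xs = \<open>xs = y # ys\<close> Cons
        \<comment> \<open>Two heavy vertices are never consecutive, so \<open>w\<close> is light;
          dropping \<open>z\<close> and \<open>y\<close> removes one vertex of each sort.\<close>
        have lw: "light w" "\<not> heavy w" using 1 xs hy heavy_or_light by auto
        have "E z y" "E y w" "z \<noteq> w" using 1 xs by auto
        then have "E z w" using heavy_light_nbrs_clique[OF hy 1(6) lw(1)] sym by blast
        then have zw: "(z, w) \<in> light_edges" using 1(6) lw unfolding light_edges_def by simp
        have "(\<forall>x\<in>set ws. light x \<longrightarrow> (w, x) \<in> light_edges\<^sup>*)
          \<and> length (filter heavy (w # ws)) \<le> length (filter light (w # ws))"
          by (rule "1.IH"[rule_format]) (use 1(2-5) xs lw in auto)
        then show ?thesis using zw zh 1(6) lw hy False xs by (auto intro: converse_rtrancl_into_rtrancl)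
      qed
    qed
  qed
qed


text \<open>Otherwise \<open>alternating_path\<close>, applied to a Hamiltonian cycle read from a
  light vertex, shows that heavy vertices do not outnumber light ones and that all light vertices
  lie in one component. Whether it is a segment or a clique, degrees give a contradiction.\<close>

lemma heavy_edge:
  assumes h: "heavy h"
  shows "\<exists>xs. hamiltonian_list V E xs \<and> heavy (hd xs) \<and> heavy (last xs)"
proof (rule ccontr)
  assume "\<not> ?thesis"
  then have none: "\<not> (heavy (hd xs) \<and> heavy (last xs))" if "hamiltonian_list V E xs" for xs
    using that by blast
  obtain q where q: "hamiltonian_list V E q" using hamiltonian[OF h] by blast
  have qne: "q \<noteq> []" using q card3 unfolding hamiltonian_list_def by auto
  then have "hd q \<in> V" "last q \<in> V" using q unfolding hamiltonian_list_def by auto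
  then obtain z where z: "z \<in> V" "light z" using none[OF q] heavy_or_light by blast
  then obtain as bs where "q = as @ z # bs" using q unfolding hamiltonian_list_def by (metis split_list)
  then obtain xs where ham: "hamiltonian_list V E (z # xs)"
    using hamiltonian_list_rotate[of V E as "z # bs"] q by auto
  then have xs: "distinct (z # xs)" "set (z # xs) = V" "successively E (z # xs)"
    unfolding hamiltonian_list_def by auto
  have "successively (\<lambda>x y. \<not> (heavy x \<and> heavy y)) (z # xs)"
    unfolding successively_conv_nth
  proof (intro allI impI)
    fix i assume i: "Suc i < length (z # xs)"
    then obtain ys where "hamiltonian_list V E ys" "hd ys = (z # xs) ! Suc i" "last ys = (z # xs) ! i"
      using hamiltonian_list_rotate_edge[OF ham] by blast
    then show "\<not> (heavy ((z # xs) ! i) \<and> heavy ((z # xs) ! Suc i))" using none by metis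
  qed
  note alt = alternating_path[OF xs(3) this xs(1) equalityD1[OF xs(2)] z(2)]
  have reach: "(z, y) \<in> light_edges\<^sup>*" if "light y" for y
    using alt xs(2) that unfolding light_def by auto
  have le: "length (filter heavy (z # xs)) \<le> length (filter light (z # xs))"
    using alt by blast
  define H where "H = {x. heavy x}"
  define L where "L = {x. light x}"
  have HL: "H \<union> L = V" "H \<inter> L = {}" "finite H" "finite L"
    using heavy_or_light fin unfolding H_def L_def heavy_def light_def by (auto intro: finite_subset[of _ V])
  have filt: "length (filter P (z # xs)) = card {x. P x}" if "\<And>x. P x \<Longrightarrow> x \<in> V" for P
  proof -
    have "distinct (filter P (z # xs))" using xs(1) by (rule distinct_filter)
    moreover have "set (filter P (z # xs)) = {x. P x}" using xs(2) that by auto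
    ultimately show ?thesis by (metis distinct_card)
  qed
  have HleL: "card H \<le> card L"
    using le filt[of heavy] filt[of light] unfolding H_def L_def heavy_def light_def by simp
  have n: "card V = card H + card L" using HL by (metis card_Un_disjoint)
  \<comment> \<open>The degree of \<open>x\<close> exceeds \<open>n / 2 \<ge> card H\<close>, and at
    most \<open>card H - 1\<close> neighbours are heavy.\<close>
  have heavy_lights: "2 \<le> card {y \<in> L. E x y}" if "x \<in> H" for x
  proof -
    have "{y. E x y} \<subseteq> (H - {x}) \<union> {y \<in> L. E x y}" using HL(1) inV irr by blast
    then have "degree V E x \<le> card ((H - {x}) \<union> {y \<in> L. E x y})"
      unfolding degree_eq by (intro card_mono) (use HL in auto)
    also have "\<dots> \<le> card (H - {x}) + card {y \<in> L. E x y}" by (rule card_Un_le)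
    also have "card (H - {x}) = card H - 1" using that by simp
    finally have "degree V E x \<le> card H - 1 + card {y \<in> L. E x y}" .
    moreover have "0 < card H" using that HL by (metis card_gt_0_iff empty_iff)
    moreover have "card V < 2 * degree V E x" using that unfolding H_def heavy_def by simp
    ultimately show ?thesis using n HleL by linarith
  qed
  have hH: "h \<in> H" using h unfolding H_def by simp
  show False
  proof (cases "\<exists>u v w. light_pair u v w")
    case True
    then obtain p a b u where p: "segment p" "block p a b" "u \<in> set p" using light_pair_block[OF _ h] by blast
    have lu: "light u" and closed: "light_closed (set p)" using p unfolding block_def light_path_def by auto
    have "L \<subseteq> set p"
    proof
      fix y assume "y \<in> L"
      then have "(u, y) \<in> light_edges\<^sup>*"
        using reach[OF lu, THEN light_edges_rtrancl_sym] reach[of y] unfolding L_def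
        by (metis mem_Collect_eq rtrancl_trans)
      then show "y \<in> set p" using light_closed_rtrancl[OF closed] p(3) by blast
    qed
    moreover have "h \<notin> set p" using p h heavy_or_light unfolding block_def light_path_def heavy_def by blast
    \<comment> \<open>So \<open>h\<close> sees light vertices only at the ends of the segment, and
      not both, as these are nonadjacent. This leaves at most one light neighbour.\<close>
    ultimately have ends: "y = hd p \<or> y = last p" if "y \<in> L" "E h y" for y
      using segment_internal[OF p(1), of y h] that sym by blast
    have "\<not> (E h (hd p) \<and> E h (last p))"
      using heavy_light_nbrs_clique[OF h, of "hd p" "last p"] segment_ends[OF p(1)] p(1)
      unfolding segment_def by blast
    then have "\<exists>e. {y \<in> L. E h y} \<subseteq> {e}" using ends by blast
    then obtain e where "{y \<in> L. E h y} \<subseteq> {e}" by blast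
    then have "card {y \<in> L. E h y} \<le> card {e}" by (intro card_mono) auto
    then show False using heavy_lights[OF hH] by simp
  next
    case False
    have cl: "E x y" if "x \<in> L" "y \<in> L" "x \<noteq> y" for x y
    proof -
      have "(x, y) \<in> light_edges\<^sup>*"
        using reach[of x, THEN light_edges_rtrancl_sym] reach[of y] that unfolding L_def
        by (metis mem_Collect_eq rtrancl_trans)
      then show ?thesis using light_component_clique[of x y] False that by blast
    qed
    have deg: "card L + card {y \<in> H. E l y} \<le> Suc (degree V E l)" if l: "l \<in> L" for l
    proof -
      have "card ((L - {l}) \<union> {y \<in> H. E l y}) \<le> degree V E l"
        unfolding degree_eq by (intro card_mono) (use cl l in auto)
      moreover have "card ((L - {l}) \<union> {y \<in> H. E l y}) = card (L - {l}) + card {y \<in> H. E l y}"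
        by (rule card_Un_disjoint) (use HL in auto)
      moreover have "card L = Suc (card (L - {l}))" using card_Suc_Diff1[OF HL(4) l] by simp
      ultimately show ?thesis by simp
    qed
    have half: "2 * degree V E l \<le> card V" if "l \<in> L" for l using that unfolding L_def light_def by simp
    \<comment> \<open>A light vertex has \<open>card L - 1\<close> light neighbours and degree at
      most \<open>n / 2 \<le> card L\<close>. Hence the light neighbourhoods of different heavy
      vertices are disjoint.\<close>
    have one: "card {y \<in> H. E l y} \<le> 1" if "l \<in> L" for l
      using deg[OF that] half[OF that] n HleL by linarith
    have disj: "{y \<in> L. E x y} \<inter> {y \<in> L. E x' y} = {}" if "x \<in> H" "x' \<in> H" "x \<noteq> x'" for x x'
    proof (rule ccontr)
      assume "\<not> ?thesis"
      then obtain l where l: "l \<in> L" "E l x" "E l x'" using sym by blast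
      then have "card {x, x'} \<le> card {y \<in> H. E l y}" by (intro card_mono) (use HL that in auto)
      then show False using one[OF l(1)] that(3) by simp
    qed
    have "2 * card H = (\<Sum>x\<in>H. 2)" by simp
    also have "\<dots> \<le> (\<Sum>x\<in>H. card {y \<in> L. E x y})" by (rule sum_mono) (rule heavy_lights)
    also have "\<dots> = card (\<Union>x\<in>H. {y \<in> L. E x y})"
      by (rule card_UN_disjoint[symmetric]) (use HL disj in auto)
    also have "\<dots> \<le> card L" by (rule card_mono) (use HL in auto)
    finally have two: "2 * card H \<le> card L" .
    \<comment> \<open>A light vertex with a heavy neighbour has degree at least
      \<open>card L\<close>, which exceeds \<open>n / 2\<close> by \<open>two\<close>.\<close>
    have "{y \<in> L. E h y} \<noteq> {}" using heavy_lights[OF hH] by (metis card.empty not_numeral_le_zero)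
    then obtain l where l: "l \<in> L" "E l h" using sym by blast
    have "{y \<in> H. E l y} \<noteq> {}" using l hH by blast
    then have "0 < card {y \<in> H. E l y}" using HL by (simp add: card_gt_0_iff)
    moreover have "0 < card H" using hH HL by (auto simp: card_gt_0_iff)
    ultimately show False using deg[OF l(1)] half[OF l(1)] n two by linarith
  qed
qed

lemma pancyclic_or_cycle_graph: "pancyclic V E \<or> is_cycle_graph V E"
proof (cases "\<exists>h. heavy h")
  case True
  then obtain xs where xs: "hamiltonian_list V E xs" "heavy (hd xs)" "heavy (last xs)"
    using heavy_edge by blast
  then show ?thesis
    using pancyclic_of_heavy_edge[OF xs(1) card3] unfolding heavy_def by linarith
next
  case False
  then have "\<And>x. x \<in> V \<Longrightarrow> light x" using heavy_or_light by blast
  then show ?thesis using two_regular_cycle_graph all_light_two_regular by blast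
qed

end

section \<open>Exceptional graphs on four vertices, and the induced claws and copies of
  \<open>Z1\<close>\<close>

context two_connected_graph
begin

text \<open>This is the case ruled out by \<open>far\<close>. As \<open>u\<close> sees all
  \<open>n - 2\<close> vertices other than \<open>u\<close> and \<open>v\<close>, being light forces
  \<open>n \<le> 4\<close>; for \<open>n = 3\<close>, \<open>w\<close> would be a cut vertex. What
  remains is the 4-cycle \<open>u w v t\<close>, with or without the chord
  \<open>wt\<close>.\<close>

lemma common_nbrs_cover:
  assumes p: "light_pair u v w"
    and cover: "\<And>r. r \<in> V \<Longrightarrow> r = u \<or> r = v \<or> (E u r \<and> E v r)"
  shows "pancyclic V E \<or> is_cycle_graph V E"
proof -
  have uv: "u \<in> V" "v \<in> V" "w \<in> V" "u \<noteq> v" "\<not> E u v" "E u w" "E v w" "E w u" "E w v"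
    "w \<noteq> u" "w \<noteq> v"
    using p sym[of u w] sym[of v w] irr[of u] irr[of v] unfolding light_pair_def light_def by (auto dest: inV)
  have "V - {u, v} \<subseteq> {y. E u y}" using cover by blast
  then have "card (V - {u, v}) \<le> degree V E u" unfolding degree_eq by (intro card_mono) auto
  moreover have "card (V - {u, v}) = card V - 2" using uv by (simp add: card_Diff_subset)
  ultimately have n4: "card V \<le> 4" using p unfolding light_pair_def light_def by linarith
  have "V \<noteq> {u, v, w}"
  proof
    assume V: "V = {u, v, w}"
    have "v \<in> V - {w}" "v \<notin> {u}" "{u} \<subseteq> V - {w}" using uv(1,2,4,10,11) by simp_all
    then have "\<exists>x\<in>{u}. \<exists>y\<in>V - {w} - {u}. E x y" by (intro cut1[OF uv(3)]) auto
    then show False unfolding V using uv(5) by auto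
  qed
  then obtain t where t: "t \<in> V" "t \<noteq> u" "t \<noteq> v" "t \<noteq> w" using uv(1-3) by blast
  then have tt: "E u t" "E v t" "E t u" "E t v" using cover sym by blast+
  have c4: "card {u, w, v, t} = 4" using uv t by auto
  have V: "V = {u, w, v, t}"
    using card_seteq[OF fin, of "{u, w, v, t}"] uv(1-3) t(1) c4 n4 by simp
  have ham: "is_cycle V E [u, w, v, t]"
    by (rule is_cycleI) (use uv t tt in auto)
  show ?thesis
  proof (cases "E w t")
    case True
    then have tri: "is_cycle V E [u, w, t]"
      by (intro is_cycleI) (use uv t tt in auto)
    have "k = 3 \<or> k = 4" if "3 \<le> k" "k \<le> card V" for k using that n4 by linarith
    moreover have "length [u, w, t] = 3" "length [u, w, v, t] = 4" by simp_all
    ultimately have "pancyclic V E" unfolding pancyclic_def using tri ham by metis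
    then show ?thesis ..
  next
    case False
    then have "\<not> E t w" using sym by blast
    have "\<exists>i<length [u, w, v, t]. {x, y} = {[u, w, v, t] ! i, [u, w, v, t] ! ((i + 1) mod length [u, w, v, t])}"
      if e: "E x y" for x y
    proof -
      have "{x, y} \<in> {{u, w}, {w, v}, {v, t}, {t, u}}"
        using inV[OF e] e irr uv(5) sym[of v u] False \<open>\<not> E t w\<close> unfolding V by auto
      then consider "{x, y} = {u, w}" | "{x, y} = {w, v}" | "{x, y} = {v, t}" | "{x, y} = {t, u}" by blast
      then show ?thesis
      proof cases
        case 1 then show ?thesis by (intro exI[of _ 0]) simp
      next
        case 2 then show ?thesis by (intro exI[of _ 1]) simp
      next
        case 3 then show ?thesis by (intro exI[of _ 2]) simp
      next
        case 4 then show ?thesis by (intro exI[of _ 3]) simp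
      qed
    qed
    then have "is_cycle_graph V E" unfolding is_cycle_graph_def
      using ham V by (intro exI[of _ "[u, w, v, t]"]) auto
    then show ?thesis ..
  qed
qed

lemma light_pair_not_induced:
  assumes "R_f1_heavy V E RV RE" "bij_betw f RV S" "S \<subseteq> V"
    and "\<And>x y. x \<in> RV \<Longrightarrow> y \<in> RV \<Longrightarrow> RE x y \<longleftrightarrow> E (f x) (f y)"
    and p: "light_pair u v w" and "u \<in> S" "v \<in> S" "w \<in> S"
  shows False
proof -
  have "f1_heavy V E S" using assms unfolding R_f1_heavy_def induced_iso_def by blast
  moreover have "dist2_in S E u v" using assms sym unfolding dist2_in_def light_pair_def by blast
  ultimately have "real (max (degree V E u) (degree V E v)) \<ge> (real (card V) + 1) / 2"
    using assms unfolding f1_heavy_def by blast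
  moreover have "2 * max (degree V E u) (degree V E v) \<le> card V"
    using p unfolding light_pair_def light_def by (simp add: max_def)
  then have "2 * real (max (degree V E u) (degree V E v)) \<le> real (card V)"
    by (metis of_nat_le_iff of_nat_mult of_nat_numeral)
  ultimately show False by simp
qed

lemma claw_light_nbr:
  assumes "R_f1_heavy V E claw_V claw_E" and p: "light_pair u v w"
    and x: "E w x" "x \<noteq> u" "x \<noteq> v"
  shows "E u x \<or> E v x"
proof (rule ccontr)
  assume n: "\<not> (E u x \<or> E v x)"
  let ?f = "\<lambda>i::nat. if i = 0 then w else if i = 1 then u else if i = 2 then v else x"
  have e: "E w u" "E u w" "E w v" "E v w" "E x w" "\<not> E u v" "\<not> E v u" "\<not> E u x" "\<not> E x u"
    "\<not> E v x" "\<not> E x v" "u \<noteq> v" "w \<noteq> u" "w \<noteq> v" "w \<noteq> x" "u \<in> V" "v \<in> V" "w \<in> V" "x \<in> V"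
    using p x n sym[of u w] sym[of v w] sym[of w x] sym[of v u] sym[of u x] sym[of x u] sym[of v x] sym[of x v]
      irr[of w] irr[of u] irr[of v] inV[of w x] inV[of u w] inV[of v w]
    unfolding light_pair_def by auto
  show False
  proof (rule light_pair_not_induced[OF assms(1) _ _ _ p])
    show "bij_betw ?f claw_V {w, u, v, x}"
      unfolding bij_betw_def inj_on_def claw_V_def using e x by auto
    show "claw_E i j \<longleftrightarrow> E (?f i) (?f j)" if "i \<in> claw_V" "j \<in> claw_V" for i j
      using that e x irr unfolding claw_E_def claw_V_def by auto
  qed (use e in auto)
qed

lemma Z1_light_nbr:
  assumes "R_f1_heavy V E Z1_V Z1_E" and p: "light_pair u v w"
    and x: "E w x" "x \<noteq> u" "x \<noteq> v" "E u x"
  shows "E v x"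
proof (rule ccontr)
  assume n: "\<not> E v x"
  \<comment> \<open>The triangle \<open>1, 2, 3\<close> goes to \<open>u, x, w\<close>, and the
    pendant vertex \<open>4\<close> goes to \<open>v\<close>, attached at \<open>w\<close>.\<close>
  let ?f = "\<lambda>i::nat. if i = 1 then u else if i = 2 then x else if i = 3 then w else v"
  have e: "E w u" "E u w" "E w v" "E v w" "E x w" "\<not> E u v" "\<not> E v u" "E u x" "E x u"
    "\<not> E v x" "\<not> E x v" "u \<noteq> v" "w \<noteq> u" "w \<noteq> v" "w \<noteq> x" "u \<in> V" "v \<in> V" "w \<in> V" "x \<in> V"
    using p x n sym[of u w] sym[of v w] sym[of w x] sym[of v u] sym[of u x] sym[of x u] sym[of v x] sym[of x v]
      irr[of w] irr[of u] irr[of v] inV[of w x] inV[of u w] inV[of v w]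
    unfolding light_pair_def by auto
  show False
  proof (rule light_pair_not_induced[OF assms(1) _ _ _ p])
    show "bij_betw ?f Z1_V {w, u, v, x}"
      unfolding bij_betw_def inj_on_def Z1_V_def using e x by auto
    show "Z1_E i j \<longleftrightarrow> E (?f i) (?f j)" if "i \<in> Z1_V" "j \<in> Z1_V" for i j
      using that e x irr unfolding Z1_E_def Z1_V_def by (auto simp: doubleton_eq_iff)
  qed (use e in auto)
qed

end

theorem theorem9:
  fixes V :: "'a set" and E :: "'a \<Rightarrow> 'a \<Rightarrow> bool"
  assumes "graph V E"
    and "two_connected V E"
    and "\<not> is_cycle_graph V E"
    and "R_f1_heavy V E claw_V claw_E"
    and "R_f1_heavy V E Z1_V Z1_E"
  shows "pancyclic V E"
proof -
  have con: "connected_on V E" "\<And>z. z \<in> V \<Longrightarrow> connected_on (V - {z}) E" "3 \<le> card V"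
    using assms(2) unfolding two_connected_def by auto
  interpret two_connected_graph V E
  proof
    show "finite V" "\<And>x y. E x y \<Longrightarrow> E y x" "\<And>x. \<not> E x x" "\<And>x y. E x y \<Longrightarrow> x \<in> V \<and> y \<in> V"
      using assms(1) unfolding graph_def by blast+
    show "3 \<le> card V" by (rule con)
    show "\<exists>x\<in>S. \<exists>y\<in>V - S. E x y" if "S \<subseteq> V" "S \<noteq> {}" "S \<noteq> V" for S
      using connected_on_cut[OF con(1) that] .
    show "\<exists>x\<in>S. \<exists>y\<in>V - {z} - S. E x y" if "z \<in> V" "S \<subseteq> V - {z}" "S \<noteq> {}" "S \<noteq> V - {z}" for z S
      using connected_on_cut[OF con(2)[OF that(1)] that(2-4)] .
  qed
  show ?thesis
  proof (cases "\<exists>u v w. light_pair u v w \<and> (\<forall>r\<in>V. r = u \<or> r = v \<or> (E u r \<and> E v r))")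
    case True
    then show ?thesis using common_nbrs_cover assms(3) by blast
  next
    case False
    interpret claw_Z1_heavy V E
    proof
      fix u v w x assume a: "light_pair u v w" "E w x" "x \<noteq> u" "x \<noteq> v"
      show "E u x \<and> E v x"
        \<comment> \<open>The claw condition makes \<open>x\<close> adjacent to one of
          \<open>u\<close>, \<open>v\<close>; the \<open>Z1\<close> condition, for the pair in
          either order, then gives the other.\<close>
        using claw_light_nbr[OF assms(4) a] Z1_light_nbr[OF assms(5) a]
          Z1_light_nbr[OF assms(5) light_pair_sym[OF a(1)] a(2,4,3)] by blast
    next
      fix u v w assume "light_pair u v w"
      then show "\<exists>r\<in>V. r \<noteq> u \<and> r \<noteq> v \<and> \<not> (E u r \<and> E v r)" using False by blast
    qed
    show ?thesis using pancyclic_or_cycle_graph assms(3) by blast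
  qed
qed

end
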